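(* Let $\{(x^k,z^k,\lambda^k)\}_{k\in\mathbb{N}}$ be a sequence generated by MEAL (with fixed penalty parameter $\beta$) with a finite initial guess $(x^0,z^0,\lambda^0)$ such that $\|z^0\|\le\mathcal{B}_1$. Suppose that: (i) $\mathcal{X}:=\{x\in\mathbb{R}^n:Ax=b\}$ is nonempty; (ii) $f:\mathbb{R}^n\to\mathbb{R}$ is proper, lower semicontinuous, $\rho$-weakly convex ($\rho>0$), and satisfies the implicit Lipschitz subgradient property with constant $L_f>0$ (possibly depending on $\gamma$); (iii) (coercivity) $f^*:=\inf_{x\in\mathcal{X}}f(x)$ is finite and $f$ is coercive over $\mathcal{X}$, i.e. $f(x)\to\infty$ if $x\in\mathcal{X}$ and $\|x\|\to\infty$; (iv) (local stability) there exist $\delta>0$ and $\bar M$ with $0<\bar M<\frac{2}{\sqrt{\tilde\sigma_{\min}(A^TA)}}$ such that for every $z\in\mathbb{R}^n$ with $\|z\|\le\mathcal{B}_1$, $$\|x(u;z)-x(b;z)\|\le\bar M\|u-b\|,\quad\forall u\in\mathrm{Im}(A)\cap\{v:\|v-b\|\le\delta\}.$$ If $\gamma\in(0,\rho^{-1})$, $\eta\in(0,2)$ and $$\beta>\max\left\{\frac{1+\sqrt{1+\eta(2-\eta)\gamma c_{\gamma,A}\alpha_{\max}}}{2c_{\gamma,A}\alpha_{\max}},\ \frac{a_2+\sqrt{a_2^2+4a_1a_3}}{2a_1}\right\},$$ where $\alpha_{\max}:=\min\left\{\frac{1-\gamma\rho}{4\gamma(1+\gamma L_f)^2},\frac1{8\gamma}\big(\frac2\eta-1\big)\right\}$,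 $c_{\gamma,A}=\gamma^2\tilde\sigma_{\min}(A^TA)$, $a_1=4-\bar M^2\tilde\sigma_{\min}(A^TA)$, $a_2=4(\bar L+\gamma^{-1})\bar M^2-\gamma\eta(2-\eta)$, $a_3=(1+\gamma\bar L)\eta(2-\eta)\bar M^2$ and $\bar L=\rho+2L_f$, then the following hold: (a) $\{\mathcal{E}^k_{\mathrm{meal}}\}$ is lower bounded; (b) $\{(x^k,z^k)\}$ is bounded; and (c) if further $\lambda^0\in\mathrm{Null}(A^T)$ (the null space of $A^T$) and $\|\nabla\mathcal{M}_{\gamma,f}(w^1)\|$ is finite with $w^1=z^0-\gamma A^T\lambda^1$, then $\{\lambda^k\}$ is bounded.
   Context: The problem is to minimize $f(x)$ over $x\in\mathbb{R}^n$ subject to $Ax=b$, with $A\in\mathbb{R}^{m\times n}$, $b\in\mathbb{R}^m$. $\|\cdot\|$ is the Euclidean norm; $\mathrm{Im}(A)$ is the image of $A$; $\tilde\sigma_{\min}(A^TA)$ is the smallest positive eigenvalue of $A^TA$. A function $h$ is $\rho$-weakly convex ($\rho>0$) if $h+\frac{\rho}{2}\|\cdot\|^2$ is convex. Moreau envelope and prox: $\mathcal{M}_{\gamma,h}(z)=\min_x\{h(x)+\frac1{2\gamma}\|x-z\|^2\}$, $\mathrm{Prox}_{\gamma,h}(z)=\operatorname{argmin}_x\{h(x)+\frac1{2\gamma}\|x-z\|^2\}$. If $h$ is proper, lower semicontinuous, $\rho$-weakly convex and $\gamma\in(0,\rho^{-1})$, the prox is single-valued and $\mathcal{M}_{\gamma,h}$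 is differentiable with $\nabla\mathcal{M}_{\gamma,h}(z)=\gamma^{-1}(z-\mathrm{Prox}_{\gamma,h}(z))$. For $x\in\mathrm{ran}(\mathrm{Prox}_{\gamma,h})$ let $\mathrm{Prox}_{\gamma,h}^{-1}(x)=\{w:\mathrm{Prox}_{\gamma,h}(w)=x\}$. Implicit Lipschitz subgradient property of $h$: for any $\gamma\in(0,\rho^{-1})$ there is $L>0$ (depending on $\gamma$) such that for all $u,v\in\mathrm{ran}(\mathrm{Prox}_{\gamma,h})$, all $w\in\mathrm{Prox}_{\gamma,h}^{-1}(u)$ and $w'\in\mathrm{Prox}_{\gamma,h}^{-1}(v)$: $\|\nabla\mathcal{M}_{\gamma,h}(w)-\nabla\mathcal{M}_{\gamma,h}(w')\|\le L\|u-v\|$. $\mathcal{L}_\beta(x,\lambda)=f(x)+\langle\lambda,Ax-b\rangle+\frac\beta2\|Ax-b\|^2$ and $\mathcal{P}_\beta(x,z,\lambda)=\mathcal{L}_\beta(x,\lambda)+\frac1{2\gamma}\|x-z\|^2$. MEAL with fixed $\beta$: for $k=0,1,\dots$: $x^{k+1}=\operatorname{argmin}_x\{\mathcal{L}_{\beta}(x,\lambda^k)+\frac1{2\gamma}\|x-z^k\|^2\}$, $z^{k+1}=z^k-\eta(z^k-x^{k+1})$, $\lambda^{k+1}=\lambda^k+\beta(Ax^{k+1}-b)$. With $\alpha=\frac{2\beta+\gamma\eta(1-\eta/2)}{2c_{\gamma,A}\beta^2}$, for $k\ge1$: $\mathcal{E}^k_{\mathrm{meal}}=\mathcal{P}_{\beta}(x^k,z^k,\lambda^k)+2\alpha\|z^k-z^{k-1}\|^2$.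 Let $\mathcal{E}^0:=\mathcal{E}^1_{\mathrm{meal}}<+\infty$. By coercivity there is a constant $\mathcal{B}_0>0$ (possibly depending on $\mathcal{E}^0$) such that $\|x\|\le\mathcal{B}_0$ whenever $x\in\mathcal{X}$ and $f(x)\le\mathcal{E}^0$. Put $\mathcal{B}_1:=\mathcal{B}_0+\sqrt{2\rho^{-1}\max\{0,\mathcal{E}^0-f^*\}}$. For $z\in\mathbb{R}^n$ with $\|z\|\le\mathcal{B}_1$ and $u\in\mathrm{Im}(A)$, $x(u;z):=\operatorname{argmin}_{\{x:Ax=u\}}\{f(x)+\frac1{2\gamma}\|x-z\|^2\}$ (unique for $\gamma\in(0,\rho^{-1})$). The constants $\delta$ and $\bar M$ may depend on $A$ and $\mathcal{B}_1$. *)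

theory Defs
  imports "HOL-Analysis.Analysis"
begin

definition lower_semicontinuous :: "('a::topological_space \<Rightarrow> real) \<Rightarrow> bool" where
  "lower_semicontinuous h \<longleftrightarrow> (\<forall>x. ereal (h x) \<le> Liminf (at x) (\<lambda>y. ereal (h y)))"

definition weakly_convex :: "real \<Rightarrow> ('a::real_inner \<Rightarrow> real) \<Rightarrow> bool" where
  "weakly_convex \<rho> h \<longleftrightarrow> convex_on UNIV (\<lambda>x. h x + \<rho> / 2 * (norm x)\<^sup>2)"

text \<open>For real-valued, lower semicontinuous, \<open>\<rho>\<close>-weakly convex \<open>h\<close> on a Euclidean space and
  \<open>0 < \<gamma> < 1 / \<rho>\<close> the infimum is attained at exactly one point and the envelope is differentiable,
  so that the three total functions below are then meaningful; outside this regime their values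
  are not used.\<close>

definition moreau_envelope :: "real \<Rightarrow> ('a::real_inner \<Rightarrow> real) \<Rightarrow> 'a \<Rightarrow> real" where
  "moreau_envelope \<gamma> h z = (INF x. h x + 1 / (2 * \<gamma>) * (norm (x - z))\<^sup>2)"

definition prox :: "real \<Rightarrow> ('a::real_inner \<Rightarrow> real) \<Rightarrow> 'a \<Rightarrow> 'a" where
  "prox \<gamma> h z = arg_min (\<lambda>x. h x + 1 / (2 * \<gamma>) * (norm (x - z))\<^sup>2) (\<lambda>_. True)"

definition gradient :: "('a::real_inner \<Rightarrow> real) \<Rightarrow> 'a \<Rightarrow> 'a" where
  "gradient h x = (THE D. GDERIV h x :> D)"

text \<open>The constant may depend on \<open>\<gamma>\<close>, hence \<open>L\<close> is a function of \<open>\<gamma>\<close>.\<close>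

definition implicit_lipschitz_subgradient ::
  "real \<Rightarrow> ('a::real_inner \<Rightarrow> real) \<Rightarrow> (real \<Rightarrow> real) \<Rightarrow> bool" where
  "implicit_lipschitz_subgradient \<rho> h L \<longleftrightarrow>
     (\<forall>\<gamma>. 0 < \<gamma> \<and> \<gamma> < 1 / \<rho> \<longrightarrow>
        0 < L \<gamma> \<and>
        (\<forall>u \<in> range (prox \<gamma> h). \<forall>v \<in> range (prox \<gamma> h).
         \<forall>w \<in> prox \<gamma> h -` {u}. \<forall>w' \<in> prox \<gamma> h -` {v}.
           norm (gradient (moreau_envelope \<gamma> h) w - gradient (moreau_envelope \<gamma> h) w')
             \<le> L \<gamma> * norm (u - v)))"

definition smallest_pos_eigenvalue :: "real^'n^'n \<Rightarrow> real" where
  "smallest_pos_eigenvalue M = (LEAST s. 0 < s \<and> (\<exists>v. v \<noteq> 0 \<and> M *v v = s *\<^sub>R v))"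

definition augmented_lagrangian ::
  "(real^'n \<Rightarrow> real) \<Rightarrow> real^'n^'m \<Rightarrow> real^'m \<Rightarrow> real \<Rightarrow> real^'n \<Rightarrow> real^'m \<Rightarrow> real" where
  "augmented_lagrangian f A b \<beta> x l =
     f x + l \<bullet> (A *v x - b) + \<beta> / 2 * (norm (A *v x - b))\<^sup>2"

definition proximal_lagrangian ::
  "(real^'n \<Rightarrow> real) \<Rightarrow> real^'n^'m \<Rightarrow> real^'m \<Rightarrow> real \<Rightarrow> real
     \<Rightarrow> real^'n \<Rightarrow> real^'n \<Rightarrow> real^'m \<Rightarrow> real" where
  "proximal_lagrangian f A b \<gamma> \<beta> x z l =
     augmented_lagrangian f A b \<beta> x l + 1 / (2 * \<gamma>) * (norm (x - z))\<^sup>2"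

definition meal_sequence ::
  "(real^'n \<Rightarrow> real) \<Rightarrow> real^'n^'m \<Rightarrow> real^'m \<Rightarrow> real \<Rightarrow> real \<Rightarrow> real
     \<Rightarrow> (nat \<Rightarrow> real^'n) \<Rightarrow> (nat \<Rightarrow> real^'n) \<Rightarrow> (nat \<Rightarrow> real^'m) \<Rightarrow> bool" where
  "meal_sequence f A b \<gamma> \<beta> \<eta> x z l \<longleftrightarrow>
     (\<forall>k. is_arg_min (\<lambda>y. augmented_lagrangian f A b \<beta> y (l k) + 1 / (2 * \<gamma>) * (norm (y - z k))\<^sup>2)
            (\<lambda>_. True) (x (Suc k)) \<and>
          z (Suc k) = z k - \<eta> *\<^sub>R (z k - x (Suc k)) \<and>
          l (Suc k) = l k + \<beta> *\<^sub>R (A *v x (Suc k) - b))"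

text \<open>Only used for \<open>k \<ge> 1\<close>.\<close>

definition meal_energy ::
  "(real^'n \<Rightarrow> real) \<Rightarrow> real^'n^'m \<Rightarrow> real^'m \<Rightarrow> real \<Rightarrow> real \<Rightarrow> real
     \<Rightarrow> (nat \<Rightarrow> real^'n) \<Rightarrow> (nat \<Rightarrow> real^'n) \<Rightarrow> (nat \<Rightarrow> real^'m) \<Rightarrow> nat \<Rightarrow> real" where
  "meal_energy f A b \<gamma> \<beta> \<alpha> x z l k =
     proximal_lagrangian f A b \<gamma> \<beta> (x k) (z k) (l k) + 2 * \<alpha> * (norm (z k - z (k - 1)))\<^sup>2"

text \<open>The solution \<open>x(u; z)\<close> of the proximal problem constrained to \<open>{x. A *v x = u}\<close>.\<close>

definition constrained_prox ::
  "(real^'n \<Rightarrow> real) \<Rightarrow> real^'n^'m \<Rightarrow> real \<Rightarrow> real^'m \<Rightarrow> real^'n \<Rightarrow> real^'n" where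
  "constrained_prox f A \<gamma> u z =
     arg_min (\<lambda>x. f x + 1 / (2 * \<gamma>) * (norm (x - z))\<^sup>2) (\<lambda>x. A *v x = u)"

definition local_stability ::
  "(real^'n \<Rightarrow> real) \<Rightarrow> real^'n^'m \<Rightarrow> real^'m \<Rightarrow> real \<Rightarrow> real \<Rightarrow> real \<Rightarrow> real \<Rightarrow> bool" where
  "local_stability f A b \<gamma> B \<delta> M \<longleftrightarrow>
     (\<forall>z. norm z \<le> B \<longrightarrow>
        (\<forall>u \<in> range ((*v) A) \<inter> {v. norm (v - b) \<le> \<delta>}.
           norm (constrained_prox f A \<gamma> u z - constrained_prox f A \<gamma> b z) \<le> M * norm (u - b)))"

end

theory Submission
  imports Defs
begin

text \<open>
  The energy does not increase from index 1 on, and it dominates the objective at a feasible point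
  close to the current iterate. Boundedness follows from these two facts.

  Since \<open>f\<close> is real-valued and weakly convex, it has a subgradient at every point \<open>u\<close>, and each
  subgradient \<open>s\<close> is the gradient of the Moreau envelope at the preimage \<open>u + \<gamma> *\<^sub>R s\<close> of \<open>u\<close> under the
  proximal map. The implicit Lipschitz property thus says that subgradients of \<open>f\<close> are Lipschitz
  (\<open>weak_subgradient_Lipschitz\<close>). The optimality condition of step \<open>k\<close> exhibits
  \<open>(1 / \<gamma>) *\<^sub>R (z k - x (Suc k)) - transpose A *v l (Suc k)\<close> as such a subgradient, so the increments of
  the multipliers are controlled by those of \<open>x\<close> and \<open>z\<close>; this gives the monotonicity of the energy
  (\<open>meal_energy_decreasing\<close>).

  For the lower bound, the iterate is compared with its orthogonal projection \<open>y\<close> onto the feasible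
  set. The distance to \<open>y\<close> is at most the norm of the residual divided by \<open>sqrt \<sigma>\<close>. The condition
  \<open>\<alpha> < \<alpha>max\<close> forces \<open>\<beta> * \<sigma>\<close> to exceed the curvature of the proximal objective several times, and so part of the penalty pays for replacing the iterate
  by \<open>y\<close>. The energy is then at least \<open>f y\<close> plus positive multiples of the squared residual and of
  \<open>(norm (y - z (Suc k)))\<^sup>2\<close> (\<open>meal_energy_lower_bound\<close>).

  Hence the energy is at least \<open>fstar\<close>. As it never exceeds \<open>E0\<close>, the points \<open>y\<close> lie in the level set
  on which the norm is at most \<open>B0\<close>, and the distances from \<open>y\<close> to both iterates are bounded. The
  vectors \<open>transpose A *v l k\<close> are bounded because the subgradients, \<open>x\<close> and \<open>z\<close> are, and
  \<open>transpose A\<close> is bounded below on the range of \<open>A\<close>, which contains every \<open>l k - l 0\<close>; so the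
  multipliers are bounded.
\<close>

section \<open>Weak subgradients\<close>

text \<open>These are the limiting subgradients of a weakly convex function. The global quadratic minorant
  is taken as the definition because it is the only property of subgradients that the estimates
  below use.\<close>

definition weak_subgradient :: "real \<Rightarrow> ('a::real_inner \<Rightarrow> real) \<Rightarrow> 'a \<Rightarrow> 'a \<Rightarrow> bool" where
  "weak_subgradient \<rho> h p s \<longleftrightarrow> (\<forall>y. h p + s \<bullet> (y - p) - \<rho> / 2 * (norm (y - p))\<^sup>2 \<le> h y)"

lemma weak_subgradientD:
  "weak_subgradient \<rho> h p s \<Longrightarrow> h p + s \<bullet> (y - p) - \<rho> / 2 * (norm (y - p))\<^sup>2 \<le> h y"
  by (simp add: weak_subgradient_def)

lemma power2_norm_add:
  "(norm (a + b))\<^sup>2 = (norm a)\<^sup>2 + 2 * (a \<bullet> b) + (norm (b::'a::real_inner))\<^sup>2"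
  by (simp add: power2_norm_eq_inner inner_simps inner_commute)

text \<open>Separate the point \<open>(p, g p)\<close> from the strict epigraph of \<open>g\<close>. The separating hyperplane is not
  vertical because \<open>g\<close> is finite everywhere, so it is the graph of an affine minorant.\<close>

lemma convex_on_imp_subgradient:
  fixes g :: "'a::euclidean_space \<Rightarrow> real"
  assumes "convex_on UNIV g"
  shows "\<exists>s. \<forall>y. g p + s \<bullet> (y - p) \<le> g y"
proof -
  define E where "E = {yt :: 'a \<times> real. g (fst yt) < snd yt}"
  have "convex E"
  proof (rule convexI)
    fix a b :: "'a \<times> real" and u v :: real
    assume ab: "a \<in> E" "b \<in> E" and uv: "0 \<le> u" "0 \<le> v" "u + v = 1"
    have "g (u *\<^sub>R fst a + v *\<^sub>R fst b) \<le> u * g (fst a) + v * g (fst b)"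
      using assms uv unfolding convex_on_def by blast
    also have "\<dots> < u * snd a + v * snd b"
    proof (cases "u = 0")
      case True
      then show ?thesis using ab uv by (simp add: E_def)
    next
      case False
      then show ?thesis
        using ab uv by (intro add_less_le_mono mult_strict_left_mono mult_left_mono) (auto simp: E_def)
    qed
    finally show "u *\<^sub>R a + v *\<^sub>R b \<in> E" by (simp add: E_def)
  qed
  moreover have "E \<noteq> {}"
    using gt_ex[of "g p"] by (auto simp: E_def)
  moreover have "{(p, g p)} \<inter> E = {}" by (auto simp: E_def)
  ultimately obtain a \<beta> where "a \<noteq> 0"
    and sep: "\<forall>q\<in>{(p, g p)}. a \<bullet> q \<le> \<beta>" "\<forall>q\<in>E. \<beta> \<le> a \<bullet> q"
    using separating_hyperplane_sets[of "{(p, g p)}" E] by auto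
  obtain a1 a2 where a: "a = (a1, a2)" by (cases a)
  have sup: "a1 \<bullet> p + a2 * g p \<le> a1 \<bullet> y + a2 * t" if "g y < t" for y t
    using sep that by (force simp: a E_def)
  have "a2 > 0"
  proof (rule ccontr)
    assume "\<not> a2 > 0"
    moreover have "a2 \<ge> 0" using sup[of p "g p + 1"] by (simp add: algebra_simps)
    ultimately have "a2 = 0" by simp
    \<comment> \<open>A vertical hyperplane would bound a linear functional on the whole space.\<close>
    then have "a1 \<bullet> p \<le> a1 \<bullet> (p - a1)" using sup[of "p - a1" "g (p - a1) + 1"] by simp
    then have "a1 \<bullet> a1 \<le> 0" by (simp add: inner_simps)
    then have "a1 = 0" by (metis antisym inner_eq_zero_iff inner_ge_zero)
    with \<open>a2 = 0\<close> \<open>a \<noteq> 0\<close> a show False by (simp add: zero_prod_def)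
  qed
  have "g p + (- (1 / a2) *\<^sub>R a1) \<bullet> (y - p) \<le> g y" for y
  proof (rule field_le_epsilon)
    fix e :: real assume "e > 0"
    then have "a1 \<bullet> p + a2 * g p \<le> a1 \<bullet> y + a2 * (g y + e)" using sup by simp
    then show "g p + (- (1 / a2) *\<^sub>R a1) \<bullet> (y - p) \<le> g y + e"
      using \<open>a2 > 0\<close> by (simp add: inner_simps field_simps)
  qed
  then show ?thesis by blast
qed

lemma weak_subgradient_exists:
  fixes h :: "'a::euclidean_space \<Rightarrow> real"
  assumes "weakly_convex \<rho> h"
  shows "\<exists>s. weak_subgradient \<rho> h p s"
proof -
  obtain s where s: "\<And>y. h p + \<rho> / 2 * (norm p)\<^sup>2 + s \<bullet> (y - p) \<le> h y + \<rho> / 2 * (norm y)\<^sup>2"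
    using convex_on_imp_subgradient[OF assms[unfolded weakly_convex_def], of p] by blast
  have "h p + (s - \<rho> *\<^sub>R p) \<bullet> (y - p) - \<rho> / 2 * (norm (y - p))\<^sup>2 \<le> h y" for y
  proof -
    have "(norm y)\<^sup>2 = (norm p)\<^sup>2 + 2 * (p \<bullet> (y - p)) + (norm (y - p))\<^sup>2"
      using power2_norm_add[of p "y - p"] by simp
    with s[of y] show ?thesis by (simp add: inner_diff_left distrib_left)
  qed
  then show ?thesis unfolding weak_subgradient_def by blast
qed

text \<open>First-order optimality. Comparing the minimizer \<open>p\<close> with \<open>p + t *\<^sub>R (y - p)\<close> and bounding \<open>h\<close> on the
  segment by weak convexity gives an inequality of order \<open>t\<close>; dividing by \<open>t\<close> and letting \<open>t\<close> tend to 0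
  removes the second-order term \<open>Q\<close>. The quadratic \<open>q\<close> is described by its expansion at \<open>p\<close>, so that
  the lemma covers the proximal term alone as well as a whole augmented Lagrangian.\<close>

lemma weak_subgradient_of_minimizer:
  fixes h :: "'a::real_inner \<Rightarrow> real"
  assumes "weakly_convex \<rho> h"
    and min: "\<And>y. h p + q p \<le> h y + q y"
    and expansion: "\<And>t d. q (p + t *\<^sub>R d) = q p + t * (g \<bullet> d) + t\<^sup>2 * Q d"
  shows "weak_subgradient \<rho> h p (- g)"
  unfolding weak_subgradient_def
proof
  fix y
  define d where "d = y - p"
  define C where "C = \<rho> / 2 * (norm d)\<^sup>2"
  have *: "0 \<le> h y - h p + g \<bullet> d + C + t * (Q d - C)" if t: "0 < t" "t < 1" for t
  proof -
    have conv: "h (p + t *\<^sub>R d) + \<rho> / 2 * (norm (p + t *\<^sub>R d))\<^sup>2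
        \<le> (1 - t) * (h p + \<rho> / 2 * (norm p)\<^sup>2) + t * (h y + \<rho> / 2 * (norm y)\<^sup>2)"
      using convex_onD[OF assms(1)[unfolded weakly_convex_def], of t p y] t
      by (simp add: d_def algebra_simps)
    have sq1: "(norm (p + t *\<^sub>R d))\<^sup>2 = (norm p)\<^sup>2 + 2 * t * (p \<bullet> d) + t\<^sup>2 * (norm d)\<^sup>2"
      by (simp add: power2_norm_add power_mult_distrib)
    have sq2: "(norm y)\<^sup>2 = (norm p)\<^sup>2 + 2 * (p \<bullet> d) + (norm d)\<^sup>2"
      using power2_norm_add[of p d] by (simp add: d_def)
    have "h (p + t *\<^sub>R d) \<le> (1 - t) * h p + t * h y + C * (t - t\<^sup>2)"
      using conv unfolding sq1 sq2 by (simp add: C_def algebra_simps add_divide_distrib diff_divide_distrib)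
    moreover have "h p \<le> h (p + t *\<^sub>R d) + t * (g \<bullet> d) + t\<^sup>2 * Q d"
      using min[of "p + t *\<^sub>R d"] by (simp add: expansion)
    ultimately have "0 \<le> t * (h y - h p + g \<bullet> d + C + t * (Q d - C))"
      by (simp add: algebra_simps power2_eq_square)
    with t show ?thesis by (simp add: zero_le_mult_iff)
  qed
  have "0 \<le> h y - h p + g \<bullet> d + C + 0 * (Q d - C)"
  proof (rule tendsto_lowerbound)
    show "((\<lambda>t. h y - h p + g \<bullet> d + C + t * (Q d - C)) \<longlongrightarrow> h y - h p + g \<bullet> d + C + 0 * (Q d - C))
            (at_right 0)"
      by (intro tendsto_intros)
    show "\<forall>\<^sub>F t in at_right 0. 0 \<le> h y - h p + g \<bullet> d + C + t * (Q d - C)"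
      using * by (auto simp: eventually_at_right_field intro!: exI[of _ 1])
  qed simp
  then show "h p + - g \<bullet> (y - p) - \<rho> / 2 * (norm (y - p))\<^sup>2 \<le> h y"
    by (simp add: d_def C_def)
qed

text \<open>The proximal objective at the point \<open>p + \<gamma> *\<^sub>R s\<close> grows quadratically away from \<open>p\<close>: its proximal term
  outweighs the negative curvature \<open>\<rho>\<close> permitted by the subgradient inequality. The first two
  summands are its value at \<open>p\<close>.\<close>

lemma prox_objective_growth:
  assumes "weak_subgradient \<rho> h p s" and "\<gamma> > 0"
  shows "h p + \<gamma> / 2 * (norm s)\<^sup>2 + 1 / 2 * (1 / \<gamma> - \<rho>) * (norm (y - p))\<^sup>2
           \<le> h y + 1 / (2 * \<gamma>) * (norm (y - (p + \<gamma> *\<^sub>R s)))\<^sup>2"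
proof -
  have "(norm (y - (p + \<gamma> *\<^sub>R s)))\<^sup>2
      = (norm (y - p))\<^sup>2 - 2 * \<gamma> * (s \<bullet> (y - p)) + \<gamma>\<^sup>2 * (norm s)\<^sup>2"
    using power2_norm_add[of "y - p" "- \<gamma> *\<^sub>R s"]
    by (simp add: power_mult_distrib inner_commute algebra_simps)
  then have "1 / (2 * \<gamma>) * (norm (y - (p + \<gamma> *\<^sub>R s)))\<^sup>2
      = 1 / (2 * \<gamma>) * (norm (y - p))\<^sup>2 - s \<bullet> (y - p) + \<gamma> / 2 * (norm s)\<^sup>2"
    using assms(2) by (simp add: field_simps power2_eq_square)
  then show ?thesis
    using weak_subgradientD[OF assms(1), of y] by (simp add: algebra_simps diff_divide_distrib)
qed

text \<open>Existence of proximal points: \<open>p\<close> is a minimizer of the proximal objective at \<open>w\<close>. A subgradient at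
  the origin makes that objective coercive, and weakly convex functions are continuous, so a
  minimizer exists on a large ball.\<close>

lemma prox_decomposition:
  fixes h :: "'a::euclidean_space \<Rightarrow> real"
  assumes wc: "weakly_convex \<rho> h" and \<gamma>: "\<gamma> > 0" "\<gamma> * \<rho> < 1"
  obtains p s where "w = p + \<gamma> *\<^sub>R s" and "weak_subgradient \<rho> h p s"
proof -
  define F where "F y = h y + 1 / (2 * \<gamma>) * (norm (y - w))\<^sup>2" for y
  define \<mu> where "\<mu> = 1 / \<gamma> - \<rho>"
  have \<mu>: "\<mu> > 0" using \<gamma> by (simp add: \<mu>_def field_simps)
  obtain s0 where s0: "weak_subgradient \<rho> h 0 s0"
    using weak_subgradient_exists[OF wc] by blast
  define g where "g = s0 - (1 / \<gamma>) *\<^sub>R w"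
  have low: "F 0 + g \<bullet> y + \<mu> / 2 * (norm y)\<^sup>2 \<le> F y" for y
  proof -
    have "(norm (y - w))\<^sup>2 = (norm y)\<^sup>2 - 2 * (w \<bullet> y) + (norm w)\<^sup>2"
      using power2_norm_add[of y "- w"] by (simp add: inner_commute)
    then have "1 / (2 * \<gamma>) * (norm (y - w))\<^sup>2
        = 1 / (2 * \<gamma>) * (norm y)\<^sup>2 - (1 / \<gamma>) * (w \<bullet> y) + 1 / (2 * \<gamma>) * (norm w)\<^sup>2"
      using \<gamma>(1) by (simp add: field_simps)
    then show ?thesis
      using weak_subgradientD[OF s0, of y]
      by (simp add: F_def g_def \<mu>_def inner_simps algebra_simps diff_divide_distrib)
  qed
  define R where "R = 2 * norm g / \<mu>"
  have "convex_on UNIV (\<lambda>x. h x + \<rho> / 2 * (norm x)\<^sup>2)" using wc by (simp add: weakly_convex_def)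
  then have "continuous_on UNIV (\<lambda>x. h x + \<rho> / 2 * (norm x)\<^sup>2)"
    by (rule convex_on_continuous[OF open_UNIV])
  moreover have "continuous_on UNIV (\<lambda>x::'a. \<rho> / 2 * (norm x)\<^sup>2)"
    by (intro continuous_intros)
  ultimately have "continuous_on UNIV (\<lambda>x. (h x + \<rho> / 2 * (norm x)\<^sup>2) - \<rho> / 2 * (norm x)\<^sup>2)"
    by (rule continuous_on_diff)
  then have "continuous_on UNIV h" by simp
  then have "continuous_on UNIV F"
    unfolding F_def by (intro continuous_intros)
  then have "continuous_on (cball 0 R) F" by (rule continuous_on_subset) simp
  moreover have "0 \<in> cball (0::'a) R" using \<mu> by (simp add: R_def)
  ultimately obtain p where p: "p \<in> cball 0 R" "\<And>y. y \<in> cball 0 R \<Longrightarrow> F p \<le> F y"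
    using continuous_attains_inf[OF compact_cball, of "0::'a" R F] by blast
  have min: "F p \<le> F y" for y
  proof (cases "y \<in> cball 0 R")
    case False
    then have "2 * norm g < \<mu> * norm y" using \<mu> by (simp add: R_def field_simps)
    then have "2 * norm g * norm y \<le> \<mu> * norm y * norm y" by (intro mult_right_mono) auto
    moreover have "- (norm g * norm y) \<le> g \<bullet> y" using Cauchy_Schwarz_ineq2[of g y] by linarith
    ultimately have "0 \<le> g \<bullet> y + \<mu> / 2 * (norm y)\<^sup>2" by (simp add: power2_eq_square)
    with low[of y] have "F 0 \<le> F y" by simp
    with p(2)[OF \<open>0 \<in> cball 0 R\<close>] show ?thesis by simp
  qed (use p in auto)
  have "weak_subgradient \<rho> h p (- ((1 / \<gamma>) *\<^sub>R (p - w)))"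
  proof (rule weak_subgradient_of_minimizer[OF wc, where Q = "\<lambda>d. 1 / (2 * \<gamma>) * (norm d)\<^sup>2"])
    show "h p + 1 / (2 * \<gamma>) * (norm (p - w))\<^sup>2 \<le> h y + 1 / (2 * \<gamma>) * (norm (y - w))\<^sup>2" for y
      using min by (simp add: F_def)
    show "1 / (2 * \<gamma>) * (norm (p + t *\<^sub>R d - w))\<^sup>2
        = 1 / (2 * \<gamma>) * (norm (p - w))\<^sup>2 + t * ((1 / \<gamma>) *\<^sub>R (p - w) \<bullet> d)
          + t\<^sup>2 * (1 / (2 * \<gamma>) * (norm d)\<^sup>2)" for t d
    proof -
      have "p + t *\<^sub>R d - w = (p - w) + t *\<^sub>R d" by simp
      then show ?thesis
        by (simp only: power2_norm_add) (simp add: power_mult_distrib distrib_left)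
    qed
  qed
  then show thesis
    using \<gamma>(1) by (intro that[of p "- ((1 / \<gamma>) *\<^sub>R (p - w))"]) auto
qed

lemma prox_weak_subgradient:
  assumes "weak_subgradient \<rho> h p s" and \<gamma>: "\<gamma> > 0" "\<gamma> * \<rho> < 1"
  shows "prox \<gamma> h (p + \<gamma> *\<^sub>R s) = p"
proof -
  define F where "F y = h y + 1 / (2 * \<gamma>) * (norm (y - (p + \<gamma> *\<^sub>R s)))\<^sup>2" for y
  have Fp: "F p = h p + \<gamma> / 2 * (norm s)\<^sup>2"
    using \<gamma> by (simp add: F_def power_mult_distrib power2_eq_square)
  have \<mu>: "1 / \<gamma> - \<rho> > 0" using \<gamma> by (simp add: field_simps)
  have growth: "F p + 1 / 2 * (1 / \<gamma> - \<rho>) * (norm (y - p))\<^sup>2 \<le> F y" for y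
    unfolding Fp using prox_objective_growth[OF assms(1,2), of y] by (simp add: F_def)
  have less: "F p < F y" if "y \<noteq> p" for y
  proof -
    have "0 < 1 / 2 * (1 / \<gamma> - \<rho>) * (norm (y - p))\<^sup>2" using \<mu> that by simp
    with growth[of y] show ?thesis by linarith
  qed
  have "arg_min F (\<lambda>_. True) = p"
    unfolding arg_min_def is_arg_min_def
    by (rule some_equality) (use less in \<open>metis less_asym' less_irrefl\<close>)+
  then show ?thesis by (simp add: prox_def F_def[abs_def])
qed

lemma moreau_envelope_weak_subgradient:
  assumes "weak_subgradient \<rho> h p s" and \<gamma>: "\<gamma> > 0" "\<gamma> * \<rho> < 1"
  shows "moreau_envelope \<gamma> h (p + \<gamma> *\<^sub>R s) = h p + \<gamma> / 2 * (norm s)\<^sup>2"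
    and "moreau_envelope \<gamma> h (p + \<gamma> *\<^sub>R s)
           \<le> h y + 1 / (2 * \<gamma>) * (norm (y - (p + \<gamma> *\<^sub>R s)))\<^sup>2"
proof -
  have \<mu>: "1 / \<gamma> - \<rho> > 0" using \<gamma> by (simp add: field_simps)
  have low: "h p + \<gamma> / 2 * (norm s)\<^sup>2 \<le> h y + 1 / (2 * \<gamma>) * (norm (y - (p + \<gamma> *\<^sub>R s)))\<^sup>2" for y
  proof -
    have "0 \<le> 1 / 2 * (1 / \<gamma> - \<rho>) * (norm (y - p))\<^sup>2" using \<mu> by simp
    with prox_objective_growth[OF assms(1,2), of y] show ?thesis by linarith
  qed
  have "h p + \<gamma> / 2 * (norm s)\<^sup>2 = h p + 1 / (2 * \<gamma>) * (norm (p - (p + \<gamma> *\<^sub>R s)))\<^sup>2"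
    using \<gamma> by (simp add: power_mult_distrib power2_eq_square)
  then have "h p + \<gamma> / 2 * (norm s)\<^sup>2
      \<in> range (\<lambda>y. h y + 1 / (2 * \<gamma>) * (norm (y - (p + \<gamma> *\<^sub>R s)))\<^sup>2)"
    by (rule range_eqI)
  then show *: "moreau_envelope \<gamma> h (p + \<gamma> *\<^sub>R s) = h p + \<gamma> / 2 * (norm s)\<^sup>2"
    unfolding moreau_envelope_def by (rule cInf_eq_minimum) (use low in blast)
  show "moreau_envelope \<gamma> h (p + \<gamma> *\<^sub>R s) \<le> h y + 1 / (2 * \<gamma>) * (norm (y - (p + \<gamma> *\<^sub>R s)))\<^sup>2"
    unfolding * by (rule low)
qed

text \<open>Lipschitz continuity of the proximal map, from the hypomonotonicity
  \<open>(s' - s) \<bullet> (p' - p) \<ge> - \<rho> (norm (p' - p))\<^sup>2\<close> of weak subgradients.\<close>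

lemma norm_diff_prox_le:
  assumes "weak_subgradient \<rho> h p s" "weak_subgradient \<rho> h p' s'" and \<gamma>: "\<gamma> > 0" "\<gamma> * \<rho> < 1"
  shows "(1 - \<gamma> * \<rho>) * norm (p' - p) \<le> norm ((p' + \<gamma> *\<^sub>R s') - (p + \<gamma> *\<^sub>R s))"
proof (cases "p' = p")
  case False
  define w where "w = (p' + \<gamma> *\<^sub>R s') - (p + \<gamma> *\<^sub>R s)"
  have "- \<rho> * (norm (p' - p))\<^sup>2 \<le> (s' - s) \<bullet> (p' - p)"
    using weak_subgradientD[OF assms(1), of p'] weak_subgradientD[OF assms(2), of p]
    by (simp add: inner_simps norm_minus_commute[of p p'])
  then have "\<gamma> * (- \<rho> * (norm (p' - p))\<^sup>2) \<le> \<gamma> * ((s' - s) \<bullet> (p' - p))"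
    using \<gamma>(1) by (intro mult_left_mono) auto
  moreover have "w \<bullet> (p' - p) = (norm (p' - p))\<^sup>2 + \<gamma> * ((s' - s) \<bullet> (p' - p))"
    by (simp add: w_def power2_norm_eq_inner inner_simps algebra_simps)
  ultimately have "(1 - \<gamma> * \<rho>) * norm (p' - p) * norm (p' - p) \<le> w \<bullet> (p' - p)"
    by (simp add: algebra_simps power2_eq_square)
  also have "\<dots> \<le> norm w * norm (p' - p)" by (rule norm_cauchy_schwarz)
  finally show ?thesis using False by (simp add: w_def)
qed simp

text \<open>Using the proximal point of one argument as a competitor at the other bounds the increment of the
  envelope from above by its linearization plus a quadratic. Exchanging the two arguments gives a
  lower bound with the subgradient \<open>s'\<close> in place of \<open>s\<close>, and \<open>s' - s\<close> is Lipschitz in the argument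
  because the proximal map is.\<close>

lemma GDERIV_moreau_envelope:
  fixes h :: "'a::euclidean_space \<Rightarrow> real"
  assumes wc: "weakly_convex \<rho> h" and s: "weak_subgradient \<rho> h p s"
    and \<gamma>: "\<gamma> > 0" "\<gamma> * \<rho> < 1"
  shows "GDERIV (moreau_envelope \<gamma> h) (p + \<gamma> *\<^sub>R s) :> s"
proof -
  let ?M = "moreau_envelope \<gamma> h" and ?w = "p + \<gamma> *\<^sub>R s"
  have upper: "?M (p2 + \<gamma> *\<^sub>R s2) - ?M (p1 + \<gamma> *\<^sub>R s1)
      \<le> s1 \<bullet> ((p2 + \<gamma> *\<^sub>R s2) - (p1 + \<gamma> *\<^sub>R s1))
        + 1 / (2 * \<gamma>) * (norm ((p2 + \<gamma> *\<^sub>R s2) - (p1 + \<gamma> *\<^sub>R s1)))\<^sup>2"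
    if "weak_subgradient \<rho> h p1 s1" "weak_subgradient \<rho> h p2 s2" for p1 s1 p2 s2
  proof -
    define d where "d = (p2 + \<gamma> *\<^sub>R s2) - (p1 + \<gamma> *\<^sub>R s1)"
    have eq: "p1 - (p2 + \<gamma> *\<^sub>R s2) = - (\<gamma> *\<^sub>R s1 + d)" by (simp add: d_def)
    have "1 / (2 * \<gamma>) * (norm (p1 - (p2 + \<gamma> *\<^sub>R s2)))\<^sup>2
        = \<gamma> / 2 * (norm s1)\<^sup>2 + s1 \<bullet> d + 1 / (2 * \<gamma>) * (norm d)\<^sup>2"
      unfolding eq norm_minus_cancel
      using \<gamma>(1) by (simp add: power2_norm_add power_mult_distrib field_simps)
        (simp add: power2_eq_square inner_commute)
    then show ?thesis
      using moreau_envelope_weak_subgradient(2)[OF that(2) \<gamma>, of p1]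
        moreau_envelope_weak_subgradient(1)[OF that(1) \<gamma>]
      by (simp add: d_def)
  qed
  define C where "C = (1 + 1 / (1 - \<gamma> * \<rho>)) / \<gamma> + 1 / (2 * \<gamma>)"
  have bound: "norm (?M v - ?M ?w - (v - ?w) \<bullet> s) \<le> C * (norm (v - ?w))\<^sup>2" for v
  proof -
    obtain p' s' where v: "v = p' + \<gamma> *\<^sub>R s'" and s': "weak_subgradient \<rho> h p' s'"
      using prox_decomposition[OF wc \<gamma>] by blast
    define d where "d = v - ?w"
    have "?M v - ?M ?w - d \<bullet> s \<le> 1 / (2 * \<gamma>) * (norm d)\<^sup>2"
      using upper[OF s s'] by (simp add: v d_def inner_commute)
    moreover have "1 / (2 * \<gamma>) * (norm d)\<^sup>2 \<le> C * (norm d)\<^sup>2"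
      using \<gamma> by (intro mult_right_mono) (auto simp: C_def)
    moreover have "- (C * (norm d)\<^sup>2) \<le> ?M v - ?M ?w - d \<bullet> s"
    proof -
      have "norm (p' - p) \<le> norm d / (1 - \<gamma> * \<rho>)"
        using norm_diff_prox_le[OF s s' \<gamma>] \<gamma> by (simp add: d_def v field_simps)
      moreover have "\<gamma> *\<^sub>R (s' - s) = d - (p' - p)"
        by (simp add: d_def v algebra_simps)
      then have "\<gamma> * norm (s' - s) \<le> norm d + norm (p' - p)"
        using norm_triangle_ineq4[of d "p' - p"] \<gamma>(1)
        by (metis abs_of_pos norm_scaleR)
      ultimately have "norm (s' - s) \<le> (1 + 1 / (1 - \<gamma> * \<rho>)) / \<gamma> * norm d"
        using \<gamma>(1) by (simp add: field_simps)
      then have "norm (s' - s) * norm d \<le> (1 + 1 / (1 - \<gamma> * \<rho>)) / \<gamma> * norm d * norm d"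
        by (intro mult_right_mono) auto
      moreover have "- (norm (s' - s) * norm d) \<le> (s' - s) \<bullet> d"
        using Cauchy_Schwarz_ineq2[of "s' - s" d] by linarith
      moreover have "?M ?w - ?M v \<le> - (s' \<bullet> d) + 1 / (2 * \<gamma>) * (norm d)\<^sup>2"
        using upper[OF s' s] norm_minus_commute[of "p + \<gamma> *\<^sub>R s" "p' + \<gamma> *\<^sub>R s'"]
        by (simp add: v d_def inner_simps algebra_simps)
      ultimately show ?thesis
        by (simp add: C_def power2_eq_square inner_simps inner_commute[of d s] algebra_simps)
    qed
    ultimately show ?thesis unfolding d_def[symmetric] by (simp add: abs_le_iff)
  qed
  show ?thesis
    unfolding gderiv_def
  proof (rule has_derivativeI_sandwich[where e = 1 and H = "\<lambda>v. C * norm (v - ?w)"])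
    show "bounded_linear (\<lambda>d. d \<bullet> s)" by (rule bounded_linear_inner_left)
    show "((\<lambda>v. C * norm (v - ?w)) \<longlongrightarrow> 0) (at ?w)"
      by (auto intro!: tendsto_eq_intros)
    show "norm (?M v - ?M ?w - (v - ?w) \<bullet> s) / norm (v - ?w) \<le> C * norm (v - ?w)"
      if "v \<noteq> ?w" for v
      using bound[of v] that by (simp add: divide_le_eq power2_eq_square mult.assoc)
  qed simp
qed

lemma gradient_eqI:
  assumes "GDERIV h x :> D"
  shows "gradient h x = D"
  unfolding gradient_def
proof (rule the_equality)
  show "GDERIV h x :> D" by (rule assms)
  fix D' assume "GDERIV h x :> D'"
  then have "(\<lambda>d. d \<bullet> D') = (\<lambda>d. d \<bullet> D)"
    using assms unfolding gderiv_def by (rule has_derivative_unique)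
  then have "\<forall>d. d \<bullet> D' = d \<bullet> D" by (simp add: fun_eq_iff)
  then show "D' = D" by (simp only: vector_eq_ldot)
qed

text \<open>Every weak subgradient \<open>s\<close> at \<open>u\<close> is the gradient of the Moreau envelope at a preimage of \<open>u\<close>,
  namely \<open>u + \<gamma> *\<^sub>R s\<close>. The implicit property is therefore an ordinary Lipschitz condition on the
  subdifferential (which it forces to be single-valued), valid at all points.\<close>

lemma weak_subgradient_Lipschitz:
  fixes h :: "'a::euclidean_space \<Rightarrow> real"
  assumes wc: "weakly_convex \<rho> h" and lip: "implicit_lipschitz_subgradient \<rho> h Lf"
    and \<rho>: "\<rho> > 0" and \<gamma>: "\<gamma> > 0" "\<gamma> * \<rho> < 1"
    and s: "weak_subgradient \<rho> h u s" and s': "weak_subgradient \<rho> h v s'"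
  shows "norm (s - s') \<le> Lf \<gamma> * norm (u - v)"
proof -
  have \<gamma>': "0 < \<gamma> \<and> \<gamma> < 1 / \<rho>" using \<gamma> \<rho> by (simp add: field_simps)
  have u: "prox \<gamma> h (u + \<gamma> *\<^sub>R s) = u" and v: "prox \<gamma> h (v + \<gamma> *\<^sub>R s') = v"
    using prox_weak_subgradient[OF s \<gamma>] prox_weak_subgradient[OF s' \<gamma>] by simp_all
  then have "u \<in> range (prox \<gamma> h)" "v \<in> range (prox \<gamma> h)" by (metis rangeI)+
  then have "norm (gradient (moreau_envelope \<gamma> h) (u + \<gamma> *\<^sub>R s)
      - gradient (moreau_envelope \<gamma> h) (v + \<gamma> *\<^sub>R s')) \<le> Lf \<gamma> * norm (u - v)"
    using lip[unfolded implicit_lipschitz_subgradient_def, rule_format, OF \<gamma>'] u v by auto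
  then show ?thesis
    using gradient_eqI[OF GDERIV_moreau_envelope[OF wc s \<gamma>]]
      gradient_eqI[OF GDERIV_moreau_envelope[OF wc s' \<gamma>]] by simp
qed

section \<open>The smallest positive eigenvalue of the Gram matrix\<close>

text \<open>On the row space the Rayleigh quotient of \<open>transpose A ** A\<close> attains its minimum \<open>\<mu>\<close>, which is
  positive since the row space meets the kernel only in 0. The row space is invariant, so a
  minimizer is an eigenvector for \<open>\<mu>\<close>; and every eigenvector for a positive eigenvalue lies in the row
  space, so no positive eigenvalue is smaller.\<close>

lemma smallest_pos_eigenvalue_le:
  fixes A :: "real^'n^'m"
  assumes "e \<in> range ((*v) (transpose A))"
  shows "smallest_pos_eigenvalue (transpose A ** A) * (norm e)\<^sup>2 \<le> (norm (A *v e))\<^sup>2"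
proof (cases "e = 0")
  case False
  define S where "S = range ((*v) (transpose A))"
  have adj: "(transpose A *v y) \<bullet> x = y \<bullet> (A *v x)" for x y
    by (simp add: dot_lmul_matrix)
  have S: "subspace S"
    unfolding S_def by (intro linear_subspace_image matrix_vector_mul_linear subspace_UNIV)
  have "e \<in> S" using assms by (simp only: S_def)
  define K where "K = S \<inter> sphere 0 1"
  have "compact K"
    unfolding K_def by (intro closed_Int_compact closed_subspace S compact_sphere)
  moreover have "e /\<^sub>R norm e \<in> K"
    using False subspace_scale[OF S \<open>e \<in> S\<close>] by (simp add: K_def)
  moreover have "continuous_on K (\<lambda>x. (norm (A *v x))\<^sup>2)"
    by (intro continuous_intros linear_continuous_on matrix_vector_mul_bounded_linear)
  ultimately obtain x0 where x0: "x0 \<in> K" and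
    min: "\<And>x. x \<in> K \<Longrightarrow> (norm (A *v x0))\<^sup>2 \<le> (norm (A *v x))\<^sup>2"
    using continuous_attains_inf[of K "\<lambda>x. (norm (A *v x))\<^sup>2"] by blast
  define \<mu> where "\<mu> = (norm (A *v x0))\<^sup>2"
  have x0': "x0 \<in> S" "norm x0 = 1" using x0 by (auto simp: K_def)
  have rayleigh: "\<mu> * (norm d)\<^sup>2 \<le> (norm (A *v d))\<^sup>2" if "d \<in> S" for d
  proof (cases "d = 0")
    case False
    then have "d /\<^sub>R norm d \<in> K" using that S by (auto simp: K_def subspace_scale)
    from min[OF this] False show ?thesis
      by (simp add: \<mu>_def matrix_vector_mult_scaleR power_mult_distrib power_inverse field_simps)
  qed simp
  have "\<mu> > 0"
  proof -
    obtain y where "x0 = transpose A *v y" using x0'(1) by (auto simp: S_def)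
    then have "x0 \<bullet> x0 = y \<bullet> (A *v x0)" using adj by metis
    moreover have "x0 \<bullet> x0 = 1" using x0'(2) by (simp add: norm_eq_1)
    ultimately have "A *v x0 \<noteq> 0" by auto
    then show ?thesis by (simp add: \<mu>_def)
  qed
  define g where "g = transpose A *v (A *v x0) - \<mu> *\<^sub>R x0"
  define N where "N = g \<bullet> g"
  define Q where "Q = (norm (A *v g))\<^sup>2 - \<mu> * (norm g)\<^sup>2"
  have "g \<in> S"
    using S x0'(1) unfolding g_def by (intro subspace_diff subspace_scale) (auto simp: S_def)
  have "Q \<ge> 0" using rayleigh[OF \<open>g \<in> S\<close>] by (simp add: Q_def)
  have quad: "0 \<le> 2 * t * N + t\<^sup>2 * Q" for t
  proof -
    have "x0 + t *\<^sub>R g \<in> S" using S x0'(1) \<open>g \<in> S\<close> by (intro subspace_add subspace_scale)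
    from rayleigh[OF this]
    have "\<mu> * (norm (x0 + t *\<^sub>R g))\<^sup>2 \<le> (norm (A *v x0 + t *\<^sub>R (A *v g)))\<^sup>2"
      by (simp add: matrix_vector_right_distrib matrix_vector_mult_scaleR)
    moreover have N: "N = (A *v x0) \<bullet> (A *v g) - \<mu> * (x0 \<bullet> g)"
      using adj[of "A *v x0" g] by (simp add: N_def g_def inner_diff_left)
    ultimately show ?thesis
      using x0'(2) unfolding N
      by (simp add: power2_norm_add Q_def power_mult_distrib algebra_simps flip: \<mu>_def)
  qed
  \<comment> \<open>The nonnegative form \<open>(norm (A *v d))\<^sup>2 - \<mu> * (norm d)\<^sup>2\<close> vanishes at \<open>x0\<close>; hence so does half its
      derivative there in direction \<open>g\<close>, which is \<open>N\<close>. Dividing by \<open>Q + 1\<close> instead of \<open>Q\<close> covers \<open>Q = 0\<close>.\<close>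
  define t where "t = N / (Q + 1)"
  have N: "N = t * (Q + 1)" using \<open>Q \<ge> 0\<close> by (simp add: t_def)
  have "0 \<le> 2 * (- t) * N + (- t)\<^sup>2 * Q" by (rule quad)
  then have "t\<^sup>2 * (Q + 2) \<le> 0" by (simp add: N power2_eq_square algebra_simps)
  then have "t = 0" using \<open>Q \<ge> 0\<close> by (simp add: mult_le_0_iff)
  then have "N = 0" by (simp add: N)
  then have eig: "(transpose A ** A) *v x0 = \<mu> *\<^sub>R x0"
    unfolding N_def g_def by (simp add: matrix_vector_mul_assoc)
  have "smallest_pos_eigenvalue (transpose A ** A) = \<mu>"
    unfolding smallest_pos_eigenvalue_def
  proof (rule Least_equality)
    show "0 < \<mu> \<and> (\<exists>v. v \<noteq> 0 \<and> (transpose A ** A) *v v = \<mu> *\<^sub>R v)"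
      using \<open>\<mu> > 0\<close> eig x0'(2) by (metis norm_zero zero_neq_one)
    fix s assume "0 < s \<and> (\<exists>v. v \<noteq> 0 \<and> (transpose A ** A) *v v = s *\<^sub>R v)"
    then obtain v where s: "s > 0" and v: "v \<noteq> 0" "transpose A *v (A *v v) = s *\<^sub>R v"
      by (auto simp: matrix_vector_mul_assoc)
    have "v = (1 / s) *\<^sub>R (transpose A *v (A *v v))" using s v(2) by simp
    moreover have "(1 / s) *\<^sub>R (transpose A *v (A *v v)) \<in> S"
      using S by (intro subspace_scale) (auto simp: S_def)
    ultimately have "v \<in> S" by simp
    have "(norm (A *v v))\<^sup>2 = s * (norm v)\<^sup>2"
      using adj[of "A *v v" v] v(2) by (simp add: power2_norm_eq_inner)
    with rayleigh[OF \<open>v \<in> S\<close>] v(1) show "\<mu> \<le> s" by simp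
  qed
  then show ?thesis using rayleigh assms by (simp add: S_def)
qed simp

text \<open>The preimage is the one in the row space, that is, the one of least norm.\<close>

lemma range_matrix_preimage:
  fixes A :: "real^'n^'m"
  assumes "r \<in> range ((*v) A)"
  obtains e where "A *v e = r"
    and "smallest_pos_eigenvalue (transpose A ** A) * (norm e)\<^sup>2 \<le> (norm r)\<^sup>2"
proof -
  define S where "S = range ((*v) (transpose A))"
  have S: "span S = S"
    unfolding span_eq_iff S_def
    by (intro linear_subspace_image matrix_vector_mul_linear subspace_UNIV)
  obtain e0 where e0: "r = A *v e0" using assms by auto
  obtain e n where e: "e \<in> S" and n: "\<And>w. w \<in> S \<Longrightarrow> orthogonal n w" and dec: "e0 = e + n"
    using orthogonal_subspace_decomp_exists[of S e0] unfolding S by metis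
  have "orthogonal n (transpose A *v (A *v n))" using n by (auto simp: S_def)
  then have "(A *v n) \<bullet> (A *v n) = 0"
    by (simp add: orthogonal_def inner_commute[of n] dot_lmul_matrix)
  then have "A *v e = r" using e0 dec by (simp add: matrix_vector_right_distrib)
  moreover from this have "smallest_pos_eigenvalue (transpose A ** A) * (norm e)\<^sup>2 \<le> (norm r)\<^sup>2"
    using smallest_pos_eigenvalue_le[of e A] e by (simp add: S_def)
  ultimately show thesis by (rule that)
qed

text \<open>By duality: pair \<open>r\<close> with its preimage of least norm.\<close>

lemma smallest_pos_eigenvalue_le_transpose:
  fixes A :: "real^'n^'m"
  assumes "r \<in> range ((*v) A)" and \<sigma>: "smallest_pos_eigenvalue (transpose A ** A) > 0"
  shows "smallest_pos_eigenvalue (transpose A ** A) * (norm r)\<^sup>2 \<le> (norm (transpose A *v r))\<^sup>2"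
proof (cases "r = 0")
  case False
  let ?\<sigma> = "smallest_pos_eigenvalue (transpose A ** A)"
  obtain e where e: "A *v e = r" "?\<sigma> * (norm e)\<^sup>2 \<le> (norm r)\<^sup>2"
    using range_matrix_preimage[OF assms(1)] by blast
  have "(norm r)\<^sup>2 = (transpose A *v r) \<bullet> e"
    by (simp add: dot_lmul_matrix e(1) power2_norm_eq_inner)
  also have "\<dots> \<le> norm (transpose A *v r) * norm e" by (rule norm_cauchy_schwarz)
  finally have "((norm r)\<^sup>2)\<^sup>2 \<le> (norm (transpose A *v r) * norm e)\<^sup>2"
    by (intro power_mono) auto
  then have "?\<sigma> * ((norm r)\<^sup>2)\<^sup>2 \<le> ?\<sigma> * (norm (transpose A *v r) * norm e)\<^sup>2"
    using \<sigma> by (intro mult_left_mono) auto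
  also have "\<dots> = (norm (transpose A *v r))\<^sup>2 * (?\<sigma> * (norm e)\<^sup>2)"
    by (simp add: power_mult_distrib)
  also have "\<dots> \<le> (norm (transpose A *v r))\<^sup>2 * (norm r)\<^sup>2"
    using e(2) by (intro mult_left_mono) auto
  finally have "?\<sigma> * (norm r)\<^sup>2 * (norm r)\<^sup>2 \<le> (norm (transpose A *v r))\<^sup>2 * (norm r)\<^sup>2"
    by (simp add: power2_eq_square mult.assoc)
  then show ?thesis using False by simp
qed simp

section \<open>One step on the proximal Lagrangian\<close>

definition lagrangian_quadratic ::
  "real^'n^'m \<Rightarrow> real^'m \<Rightarrow> real \<Rightarrow> real \<Rightarrow> real^'n \<Rightarrow> real^'m \<Rightarrow> real^'n \<Rightarrow> real" where
  "lagrangian_quadratic A b \<gamma> \<beta> z l y =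
     l \<bullet> (A *v y - b) + \<beta> / 2 * (norm (A *v y - b))\<^sup>2 + 1 / (2 * \<gamma>) * (norm (y - z))\<^sup>2"

lemma proximal_lagrangian_eq:
  "proximal_lagrangian f A b \<gamma> \<beta> y z l = f y + lagrangian_quadratic A b \<gamma> \<beta> z l y"
  by (simp add: proximal_lagrangian_def augmented_lagrangian_def lagrangian_quadratic_def)

lemma lagrangian_quadratic_expansion:
  "lagrangian_quadratic A b \<gamma> \<beta> z l (p + t *\<^sub>R d)
     = lagrangian_quadratic A b \<gamma> \<beta> z l p
       + t * ((transpose A *v (l + \<beta> *\<^sub>R (A *v p - b)) + (1 / \<gamma>) *\<^sub>R (p - z)) \<bullet> d)
       + t\<^sup>2 * (\<beta> / 2 * (norm (A *v d))\<^sup>2 + 1 / (2 * \<gamma>) * (norm d)\<^sup>2)"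
proof -
  have e1: "A *v (p + t *\<^sub>R d) - b = (A *v p - b) + t *\<^sub>R (A *v d)"
    by (simp add: matrix_vector_right_distrib matrix_vector_mult_scaleR)
  have e2: "p + t *\<^sub>R d - z = (p - z) + t *\<^sub>R d" by simp
  have e3: "(transpose A *v (l + \<beta> *\<^sub>R (A *v p - b))) \<bullet> d
      = l \<bullet> (A *v d) + \<beta> * ((A *v p - b) \<bullet> (A *v d))"
    unfolding transpose_matrix_vector dot_lmul_matrix by (simp only: inner_add_left inner_scaleR_left)
  show ?thesis
    unfolding lagrangian_quadratic_def e1 e2 power2_norm_add inner_add_left e3
    by (simp add: inner_add_right power_mult_distrib distrib_left distrib_right)
qed

lemma meal_step_weak_subgradient:
  assumes "weakly_convex \<rho> f"
    and "is_arg_min (\<lambda>y. augmented_lagrangian f A b \<beta> y l + 1 / (2 * \<gamma>) * (norm (y - z))\<^sup>2)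
           (\<lambda>_. True) p"
  shows "weak_subgradient \<rho> f p
           ((1 / \<gamma>) *\<^sub>R (z - p) - transpose A *v (l + \<beta> *\<^sub>R (A *v p - b)))"
proof -
  have "f p + lagrangian_quadratic A b \<gamma> \<beta> z l p \<le> f y + lagrangian_quadratic A b \<gamma> \<beta> z l y" for y
    unfolding proximal_lagrangian_eq[symmetric] proximal_lagrangian_def
    using assms(2) by (auto simp: is_arg_min_def not_less)
  then have "weak_subgradient \<rho> f p
      (- (transpose A *v (l + \<beta> *\<^sub>R (A *v p - b)) + (1 / \<gamma>) *\<^sub>R (p - z)))"
    by (rule weak_subgradient_of_minimizer[OF assms(1)]) (rule lagrangian_quadratic_expansion)
  moreover have "- (transpose A *v (l + \<beta> *\<^sub>R (A *v p - b)) + (1 / \<gamma>) *\<^sub>R (p - z))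
      = (1 / \<gamma>) *\<^sub>R (z - p) - transpose A *v (l + \<beta> *\<^sub>R (A *v p - b))"
    by (simp add: scaleR_diff_right)
  ultimately show ?thesis by (simp only:)
qed

text \<open>The gradient of the quadratic part at \<open>p\<close> is the negative of the subgradient of \<open>f\<close>, so only
  second-order terms remain, and their curvature is at least \<open>1 / \<gamma> - \<rho>\<close>.\<close>

lemma proximal_lagrangian_descent:
  assumes "weak_subgradient \<rho> f p
             ((1 / \<gamma>) *\<^sub>R (z - p) - transpose A *v (l + \<beta> *\<^sub>R (A *v p - b)))"
    and "\<beta> \<ge> 0"
  shows "proximal_lagrangian f A b \<gamma> \<beta> p z l + 1 / 2 * (1 / \<gamma> - \<rho>) * (norm (y - p))\<^sup>2
           \<le> proximal_lagrangian f A b \<gamma> \<beta> y z l"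
proof -
  let ?g = "transpose A *v (l + \<beta> *\<^sub>R (A *v p - b))"
  have "lagrangian_quadratic A b \<gamma> \<beta> z l y = lagrangian_quadratic A b \<gamma> \<beta> z l p
      + (?g + (1 / \<gamma>) *\<^sub>R (p - z)) \<bullet> (y - p)
      + (\<beta> / 2 * (norm (A *v (y - p)))\<^sup>2 + 1 / (2 * \<gamma>) * (norm (y - p))\<^sup>2)"
    using lagrangian_quadratic_expansion[of A b \<gamma> \<beta> z l p 1 "y - p"] by simp
  moreover have "0 \<le> \<beta> / 2 * (norm (A *v (y - p)))\<^sup>2" using assms(2) by simp
  moreover have "((1 / \<gamma>) *\<^sub>R (z - p) - ?g) \<bullet> (y - p) = - ((?g + (1 / \<gamma>) *\<^sub>R (p - z)) \<bullet> (y - p))"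
    by (simp only: inner_minus_left[symmetric]) (simp add: scaleR_diff_right)
  moreover have "1 / 2 * (1 / \<gamma> - \<rho>) * (norm (y - p))\<^sup>2
      = 1 / (2 * \<gamma>) * (norm (y - p))\<^sup>2 - \<rho> / 2 * (norm (y - p))\<^sup>2"
    by (simp add: algebra_simps diff_divide_distrib)
  ultimately show ?thesis
    using weak_subgradientD[OF assms(1), of y] unfolding proximal_lagrangian_eq by linarith
qed

lemma proximal_lagrangian_update:
  assumes "z' = z - \<eta> *\<^sub>R (z - p)" and "l' = l + \<beta> *\<^sub>R (A *v p - b)"
  shows "proximal_lagrangian f A b \<gamma> \<beta> p z' l'
           = proximal_lagrangian f A b \<gamma> \<beta> p z l + \<beta> * (norm (A *v p - b))\<^sup>2
             - \<eta> * (2 - \<eta>) / (2 * \<gamma>) * (norm (z - p))\<^sup>2"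
proof -
  have "p - z' = (1 - \<eta>) *\<^sub>R (p - z)" using assms(1) by (simp add: algebra_simps)
  then have "(norm (p - z'))\<^sup>2 = (1 - \<eta>)\<^sup>2 * (norm (z - p))\<^sup>2"
    by (simp add: power_mult_distrib norm_minus_commute)
  moreover have "(1 - \<eta>)\<^sup>2 = 1 - \<eta> * (2 - \<eta>)" by (simp add: power2_eq_square algebra_simps)
  moreover have "l' \<bullet> (A *v p - b) = l \<bullet> (A *v p - b) + \<beta> * (norm (A *v p - b))\<^sup>2"
    by (simp add: assms(2) inner_add_left power2_norm_eq_inner)
  ultimately show ?thesis
    by (simp add: proximal_lagrangian_def augmented_lagrangian_def norm_minus_commute[of p z]
        left_diff_distrib diff_divide_distrib)
qed

text \<open>Subtracting the optimality conditions of two consecutive steps expresses \<open>transpose A *v (l' - l)\<close>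
  through increments of the primal variables and of the subgradients, and \<open>transpose A\<close> is bounded
  below on the column space.\<close>

lemma multiplier_increment_bound:
  fixes A :: "real^'n^'m"
  assumes \<sigma>: "\<sigma> = smallest_pos_eigenvalue (transpose A ** A)" "\<sigma> > 0" and "\<gamma> > 0"
    and s: "s = (1 / \<gamma>) *\<^sub>R (z - p) - transpose A *v l"
    and s': "s' = (1 / \<gamma>) *\<^sub>R (z' - p') - transpose A *v l'"
    and lip: "norm (s' - s) \<le> Lf * norm (p' - p)" and "l' - l \<in> range ((*v) A)"
  shows "\<gamma>\<^sup>2 * \<sigma> * (norm (l' - l))\<^sup>2
           \<le> 2 * (1 + \<gamma> * Lf)\<^sup>2 * (norm (p' - p))\<^sup>2 + 2 * (norm (z' - z))\<^sup>2"
proof -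
  have eq: "\<gamma> *\<^sub>R (transpose A *v (l' - l)) = (z' - z) - (p' - p) - \<gamma> *\<^sub>R (s' - s)"
    using \<open>\<gamma> > 0\<close> unfolding s s' by (simp add: matrix_vector_mult_diff_distrib algebra_simps del: transpose_matrix_vector)
  have "norm (\<gamma> *\<^sub>R (transpose A *v (l' - l)))
      \<le> norm (z' - z) + norm (p' - p) + norm (\<gamma> *\<^sub>R (s' - s))"
    unfolding eq by (meson norm_triangle_ineq4 add_right_mono order_trans)
  also have "norm (\<gamma> *\<^sub>R (s' - s)) \<le> \<gamma> * (Lf * norm (p' - p))"
    using lip \<open>\<gamma> > 0\<close> by simp
  finally have "norm (\<gamma> *\<^sub>R (transpose A *v (l' - l)))
      \<le> (1 + \<gamma> * Lf) * norm (p' - p) + norm (z' - z)"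
    by (simp add: algebra_simps)
  then have "(norm (\<gamma> *\<^sub>R (transpose A *v (l' - l))))\<^sup>2
      \<le> ((1 + \<gamma> * Lf) * norm (p' - p) + norm (z' - z))\<^sup>2"
    by (intro power_mono) auto
  also have "\<dots> \<le> 2 * ((1 + \<gamma> * Lf) * norm (p' - p))\<^sup>2 + 2 * (norm (z' - z))\<^sup>2"
    using sum_squares_bound[of "(1 + \<gamma> * Lf) * norm (p' - p)" "norm (z' - z)"]
    by (simp add: power2_sum)
  finally have "\<gamma>\<^sup>2 * (norm (transpose A *v (l' - l)))\<^sup>2
      \<le> 2 * (1 + \<gamma> * Lf)\<^sup>2 * (norm (p' - p))\<^sup>2 + 2 * (norm (z' - z))\<^sup>2"
    by (simp add: power_mult_distrib del: transpose_matrix_vector)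
  moreover have "\<gamma>\<^sup>2 * (\<sigma> * (norm (l' - l))\<^sup>2) \<le> \<gamma>\<^sup>2 * (norm (transpose A *v (l' - l)))\<^sup>2"
    using smallest_pos_eigenvalue_le_transpose[OF assms(7)] \<sigma> by (intro mult_left_mono) auto
  ultimately show ?thesis by simp
qed

text \<open>The comparison point \<open>p - e\<close> is feasible. The subgradient inequality at \<open>p - e\<close> bounds \<open>f p\<close> from
  below; the optimality condition \<open>s\<close> turns the multiplier term into an inner product with \<open>e\<close>, whose
  \<open>s\<close>-part cancels the linear part of the subgradient inequality up to \<open>Lf * (norm e)\<^sup>2\<close>. The
  optimality condition refers to \<open>z\<close> but the proximal term to \<open>z'\<close>; the mismatch is a multiple of
  \<open>(z' - z) \<bullet> e\<close>, and the term \<open>2 * \<alpha> * (norm (z' - z))\<^sup>2\<close> absorbs it up to a multiple of \<open>(norm e)\<^sup>2\<close>.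
  What remains is quadratic in \<open>e\<close>, hence in the residual, and three quarters of the penalty
  \<open>\<beta> / 2 * (norm (A *v p - b))\<^sup>2\<close> pay for it.\<close>

lemma proximal_lagrangian_lower_bound:
  fixes A :: "real^'n^'m"
  assumes "\<gamma> > 0" "\<alpha> > 0"
    and r: "A *v e = A *v p - b" "\<sigma> * (norm e)\<^sup>2 \<le> (norm (A *v p - b))\<^sup>2" "\<sigma> > 0"
    and s: "s = (1 / \<gamma>) *\<^sub>R (z - p) - transpose A *v l"
    and s': "weak_subgradient \<rho> f (p - e) s'" "norm (s' - s) \<le> Lf * norm e"
    and coef: "\<rho> / 2 + Lf + 1 / (2 * \<gamma>) + 1 / (8 * \<alpha> * \<gamma>\<^sup>2) \<le> 3 / 8 * \<beta> * \<sigma>" "\<beta> > 0"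
  shows "f (p - e) + 1 / (2 * \<gamma>) * (norm (p - e - z'))\<^sup>2 + \<beta> / 8 * (norm (A *v p - b))\<^sup>2
           \<le> proximal_lagrangian f A b \<gamma> \<beta> p z' l + 2 * \<alpha> * (norm (z' - z))\<^sup>2"
proof -
  define R where "R = (norm (A *v p - b))\<^sup>2"
  define N where "N = (norm e)\<^sup>2"
  define D where "D = (norm (z' - z))\<^sup>2"
  have "f (p - e) + s' \<bullet> e - \<rho> / 2 * N \<le> f p"
    using weak_subgradientD[OF s'(1), of p] by (simp add: N_def)
  moreover have "l \<bullet> (A *v p - b) = (1 / \<gamma>) * ((z - p) \<bullet> e) - s \<bullet> e"
    unfolding r(1)[symmetric] s by (simp add: inner_diff_left dot_lmul_matrix)
  moreover have "s \<bullet> e - s' \<bullet> e \<le> Lf * N"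
  proof -
    have "s \<bullet> e - s' \<bullet> e \<le> norm (s - s') * norm e"
      using norm_cauchy_schwarz[of "s - s'" e] by (simp add: inner_diff_left)
    also have "\<dots> \<le> Lf * norm e * norm e"
      using s'(2) by (intro mult_right_mono) (simp_all add: norm_minus_commute)
    finally show ?thesis by (simp add: N_def power2_eq_square)
  qed
  moreover have "1 / (2 * \<gamma>) * (norm (p - e - z'))\<^sup>2
      = 1 / (2 * \<gamma>) * (norm (p - z'))\<^sup>2 - (1 / \<gamma>) * ((p - z') \<bullet> e) + 1 / (2 * \<gamma>) * N"
  proof -
    have "p - e - z' = (p - z') + - e" by simp
    then have "(norm (p - e - z'))\<^sup>2 = (norm (p - z'))\<^sup>2 - 2 * ((p - z') \<bullet> e) + N"
      by (simp only: power2_norm_add) (simp add: N_def)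
    then show ?thesis by (simp add: distrib_left right_diff_distrib)
  qed
  moreover have "(1 / \<gamma>) * ((z' - z) \<bullet> e) \<le> 2 * \<alpha> * D + 1 / (8 * \<alpha> * \<gamma>\<^sup>2) * N"
  proof -
    have "(1 / \<gamma>) * ((z' - z) \<bullet> e) \<le> (1 / \<gamma>) * (norm (z' - z) * norm e)"
      using \<open>\<gamma> > 0\<close> norm_cauchy_schwarz by (intro mult_left_mono) auto
    also have "\<dots> \<le> 2 * \<alpha> * D + 1 / (8 * \<alpha> * \<gamma>\<^sup>2) * N"
    proof -
      \<comment> \<open>Young's inequality, weighted so that the first term is exactly the stored \<open>2 * \<alpha> * D\<close>.\<close>
      have "0 \<le> 2 * \<alpha> * (norm (z' - z) - norm e / (4 * \<alpha> * \<gamma>))\<^sup>2" using \<open>\<alpha> > 0\<close> by simp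
      also have "\<dots> = 2 * \<alpha> * D + 1 / (8 * \<alpha> * \<gamma>\<^sup>2) * N - (1 / \<gamma>) * (norm (z' - z) * norm e)"
        using \<open>\<alpha> > 0\<close> \<open>\<gamma> > 0\<close> by (simp add: D_def N_def power2_eq_square field_simps)
      finally show ?thesis by simp
    qed
    finally show ?thesis .
  qed
  moreover have "(\<rho> / 2 + Lf + 1 / (2 * \<gamma>) + 1 / (8 * \<alpha> * \<gamma>\<^sup>2)) * N \<le> 3 / 8 * \<beta> * R"
  proof -
    have "(\<rho> / 2 + Lf + 1 / (2 * \<gamma>) + 1 / (8 * \<alpha> * \<gamma>\<^sup>2)) * N \<le> 3 / 8 * \<beta> * \<sigma> * N"
      using coef(1) by (intro mult_right_mono) (auto simp: N_def)
    also have "\<dots> = 3 / 8 * \<beta> * (\<sigma> * N)" by simp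
    also have "\<dots> \<le> 3 / 8 * \<beta> * R"
      using r(2) coef(2) by (intro mult_left_mono) (auto simp: N_def R_def)
    finally show ?thesis .
  qed
  moreover have "(\<rho> / 2 + Lf + 1 / (2 * \<gamma>) + 1 / (8 * \<alpha> * \<gamma>\<^sup>2)) * N
      = \<rho> / 2 * N + Lf * N + 1 / (2 * \<gamma>) * N + 1 / (8 * \<alpha> * \<gamma>\<^sup>2) * N"
    by (simp only: distrib_right)
  moreover have "(1 / \<gamma>) * ((z - p) \<bullet> e) + (1 / \<gamma>) * ((p - z') \<bullet> e) = - ((1 / \<gamma>) * ((z' - z) \<bullet> e))"
    by (simp add: inner_diff_left algebra_simps)
  ultimately show ?thesis
    unfolding proximal_lagrangian_def augmented_lagrangian_def R_def[symmetric] D_def[symmetric]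
    by linarith
qed

section \<open>Energy along the iteration\<close>

text \<open>The bound on \<open>\<beta>\<close> says that \<open>\<beta>\<close> exceeds the larger root of a quadratic whose positivity is
  \<open>\<alpha> < \<alpha>max\<close>. The two parts of \<open>\<alpha>max\<close> give the inequalities needed for descent. The last conclusion,
  needed for the lower bound, comes from the same source: \<open>\<alpha>\<close> exceeds \<open>1 / (c * \<beta>)\<close>, so the first part of
  \<open>\<alpha>max\<close> yields \<open>4 * (1 + \<gamma> * Lf)\<^sup>2 \<le> \<gamma> * \<sigma> * \<beta>\<close>, and thus \<open>\<beta> * \<sigma>\<close> is at least four times \<open>1 / \<gamma> + Lf\<close>.\<close>

lemma meal_parameter_bounds:
  fixes \<rho> \<gamma> \<eta> \<beta> \<sigma> c \<alpha> \<alpha>max Lf :: real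
  assumes "\<rho> > 0" "\<gamma> > 0" "\<gamma> * \<rho> < 1" "0 < \<eta>" "\<eta> < 2" "\<sigma> > 0" "Lf > 0"
    and c_def: "c = \<gamma>\<^sup>2 * \<sigma>"
    and alpha_def: "\<alpha> = (2 * \<beta> + \<gamma> * \<eta> * (1 - \<eta> / 2)) / (2 * c * \<beta>\<^sup>2)"
    and alphamax_def: "\<alpha>max = min ((1 - \<gamma> * \<rho>) / (4 * \<gamma> * (1 + \<gamma> * Lf)\<^sup>2))
                                 (1 / (8 * \<gamma>) * (2 / \<eta> - 1))"
    and beta: "\<beta> > (1 + sqrt (1 + \<eta> * (2 - \<eta>) * \<gamma> * c * \<alpha>max)) / (2 * c * \<alpha>max)"
  shows "\<beta> > 0" "\<alpha> > 0" "\<beta> \<le> \<alpha> * c * \<beta>\<^sup>2"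
    and "2 * \<alpha> * (1 + \<gamma> * Lf)\<^sup>2 \<le> 1 / 2 * (1 / \<gamma> - \<rho>)"
    and "2 * \<alpha> * \<eta>\<^sup>2 \<le> \<eta> * (2 - \<eta>) / (2 * \<gamma>)"
    and "\<rho> / 2 + Lf + 1 / (2 * \<gamma>) + 1 / (8 * \<alpha> * \<gamma>\<^sup>2) \<le> 3 / 8 * \<beta> * \<sigma>"
proof -
  have c: "c > 0" using assms by (simp add: c_def)
  have "(2 / \<eta> - 1) > 0" using assms by (simp add: field_simps)
  moreover have "1 + \<gamma> * Lf > 0" using assms(2,7) by (simp add: add_pos_pos)
  then have "0 < (1 - \<gamma> * \<rho>) / (4 * \<gamma> * (1 + \<gamma> * Lf)\<^sup>2)"
    using assms(2,3) by (intro divide_pos_pos mult_pos_pos zero_less_power) auto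
  ultimately have am: "\<alpha>max > 0" using assms(2) by (simp add: alphamax_def)
  define \<kappa> where "\<kappa> = \<eta> * (2 - \<eta>) * \<gamma>"
  have \<kappa>: "\<kappa> > 0" using assms by (simp add: \<kappa>_def)
  define K where "K = sqrt (1 + \<kappa> * c * \<alpha>max)"
  have K2: "K\<^sup>2 = 1 + \<kappa> * c * \<alpha>max" and K0: "K \<ge> 0" using c am \<kappa> by (simp_all add: K_def)
  have bK: "K < 2 * c * \<alpha>max * \<beta> - 1"
    using beta c am by (simp add: K_def \<kappa>_def field_simps)
  then have "0 < (2 * c * \<alpha>max) * \<beta>" using K0 by linarith
  then show b: "\<beta> > 0" using c am by (elim zero_less_mult_pos) simp
  have alpha: "\<alpha> * (4 * c * \<beta>\<^sup>2) = 4 * \<beta> + \<kappa>"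
    unfolding alpha_def \<kappa>_def using b c by (simp add: field_simps)
  then have "\<alpha> * (4 * c * \<beta>\<^sup>2) > 0" using b \<kappa> by simp
  then show a: "\<alpha> > 0" using b c by (elim zero_less_mult_pos2) simp
  show ac: "\<beta> \<le> \<alpha> * c * \<beta>\<^sup>2" using alpha \<kappa> by simp
  have "K\<^sup>2 < (2 * c * \<alpha>max * \<beta> - 1)\<^sup>2" using bK K0 by (intro power_strict_mono) auto
  then have "0 < c * \<alpha>max * (\<alpha>max * (4 * c * \<beta>\<^sup>2) - (4 * \<beta> + \<kappa>))"
    unfolding K2 by (simp add: power2_eq_square algebra_simps)
  then have "0 < \<alpha>max * (4 * c * \<beta>\<^sup>2) - (4 * \<beta> + \<kappa>)"
    using c am by (elim zero_less_mult_pos) simp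
  then have "\<alpha> * (4 * c * \<beta>\<^sup>2) < \<alpha>max * (4 * c * \<beta>\<^sup>2)" unfolding alpha by simp
  then have lt: "\<alpha> < \<alpha>max" using b c by simp
  define w where "w = 1 + \<gamma> * Lf"
  have w: "w > 1" using assms by (simp add: w_def)
  have lt1: "\<alpha> * (4 * \<gamma> * w\<^sup>2) < 1 - \<gamma> * \<rho>"
    using lt assms(2) w unfolding alphamax_def w_def[symmetric] by (simp add: field_simps)
  then show "2 * \<alpha> * (1 + \<gamma> * Lf)\<^sup>2 \<le> 1 / 2 * (1 / \<gamma> - \<rho>)"
    using assms(2) unfolding w_def[symmetric] by (simp add: field_simps)
  have "\<alpha> < 1 / (8 * \<gamma>) * (2 / \<eta> - 1)" using lt unfolding alphamax_def by simp
  then have "8 * \<gamma> * (\<alpha> * \<eta>) < 2 - \<eta>" using assms(2,4) by (simp add: field_simps)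
  then have "8 * \<gamma> * (\<alpha> * \<eta>) * \<eta> \<le> (2 - \<eta>) * \<eta>" using assms(4) by (intro mult_right_mono) auto
  moreover have "0 \<le> (2 - \<eta>) * \<eta>" using assms by simp
  ultimately have "4 * \<gamma> * (\<alpha> * \<eta>) * \<eta> \<le> (2 - \<eta>) * \<eta>" by simp
  then show "2 * \<alpha> * \<eta>\<^sup>2 \<le> \<eta> * (2 - \<eta>) / (2 * \<gamma>)"
    using assms(2) by (simp add: field_simps power2_eq_square)
  have acb: "1 \<le> \<alpha> * c * \<beta>" using ac b by (simp add: power2_eq_square)
  have "4 * \<gamma> * w\<^sup>2 \<le> (\<alpha> * c * \<beta>) * (4 * \<gamma> * w\<^sup>2)"
    using mult_right_mono[OF acb, of "4 * \<gamma> * w\<^sup>2"] assms(2) by simp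
  also have "\<dots> = c * \<beta> * (\<alpha> * (4 * \<gamma> * w\<^sup>2))" by simp
  also have "\<dots> \<le> c * \<beta> * 1"
    using lt1 mult_pos_pos[OF assms(2,1)] b c by (intro mult_left_mono) auto
  finally have "\<gamma> * (4 * w\<^sup>2) \<le> \<gamma> * (\<gamma> * \<sigma> * \<beta>)" by (simp add: c_def power2_eq_square)
  then have "4 * w\<^sup>2 \<le> \<gamma> * \<sigma> * \<beta>" using assms(2) by simp
  moreover have "w \<le> w\<^sup>2" using w by (simp add: power2_eq_square)
  ultimately have "4 * (1 + \<gamma> * Lf) \<le> \<gamma> * \<sigma> * \<beta>" by (simp add: w_def)
  then have t1: "1 / \<gamma> + Lf \<le> \<beta> * \<sigma> / 4" using assms(2) by (simp add: field_simps)
  have t2: "1 / (8 * \<alpha> * \<gamma>\<^sup>2) \<le> \<beta> * \<sigma> / 8"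
    using acb a assms(2) by (simp add: c_def field_simps)
  have t3: "\<rho> / 2 \<le> 1 / (2 * \<gamma>)" using assms(2,3) by (simp add: field_simps)
  have "1 / (2 * \<gamma>) + 1 / (2 * \<gamma>) = 1 / \<gamma>" using assms(2) by (simp add: field_simps)
  with t1 t2 t3 show "\<rho> / 2 + Lf + 1 / (2 * \<gamma>) + 1 / (8 * \<alpha> * \<gamma>\<^sup>2) \<le> 3 / 8 * \<beta> * \<sigma>"
    by linarith
qed

text \<open>The subgradient of \<open>f\<close> at iterate \<open>Suc k\<close> that the optimality condition of step \<open>k\<close> provides; the
  penalty term has been absorbed into the updated multiplier.\<close>

definition meal_subgradient ::
  "real^'n^'m \<Rightarrow> real \<Rightarrow> (nat \<Rightarrow> real^'n) \<Rightarrow> (nat \<Rightarrow> real^'n) \<Rightarrow> (nat \<Rightarrow> real^'m) \<Rightarrow> nat \<Rightarrow> real^'n"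
  where
  "meal_subgradient A \<gamma> x z l k
     = (1 / \<gamma>) *\<^sub>R (z k - x (Suc k)) - transpose A *v l (Suc k)"

lemma weak_subgradient_meal:
  assumes "weakly_convex \<rho> f" and "meal_sequence f A b \<gamma> \<beta> \<eta> x z l"
  shows "weak_subgradient \<rho> f (x (Suc k)) (meal_subgradient A \<gamma> x z l k)"
proof -
  have "l (Suc k) = l k + \<beta> *\<^sub>R (A *v x (Suc k) - b)"
    using assms(2) unfolding meal_sequence_def by blast
  moreover have "is_arg_min (\<lambda>y. augmented_lagrangian f A b \<beta> y (l k)
      + 1 / (2 * \<gamma>) * (norm (y - z k))\<^sup>2) (\<lambda>_. True) (x (Suc k))"
    using assms(2) unfolding meal_sequence_def by blast
  ultimately show ?thesis
    using meal_step_weak_subgradient[OF assms(1)] by (simp only: meal_subgradient_def)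
qed

lemma residual_in_range:
  fixes A :: "real^'n^'m"
  assumes "b \<in> range ((*v) A)"
  shows "t *\<^sub>R (A *v y - b) \<in> range ((*v) A)"
proof -
  obtain y0 where "b = A *v y0" using assms by auto
  then have "t *\<^sub>R (A *v y - b) = A *v (t *\<^sub>R (y - y0))"
    by (simp add: matrix_vector_mult_diff_distrib matrix_vector_mult_scaleR)
  then show ?thesis by blast
qed

text \<open>The multiplier step raises the Lagrangian by \<open>\<beta>\<close> times the squared residual. This is at most \<open>\<alpha>\<close> times
  the bound on the multiplier increment, and that splits into a part paid by the strong convexity of
  the primal step and a part already stored in the previous energy as its displacement term in
  \<open>z\<close>. The new displacement term is paid by the relaxation step. Index 0 is excluded because its iterate satisfies no
  optimality condition.\<close>

lemma meal_energy_decreasing: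
  fixes A :: "real^'n^'m"
  assumes wc: "weakly_convex \<rho> f" and meal: "meal_sequence f A b \<gamma> \<beta> \<eta> x z l"
    and lip: "\<And>u v s s'. weak_subgradient \<rho> f u s \<Longrightarrow> weak_subgradient \<rho> f v s' \<Longrightarrow>
                norm (s - s') \<le> Lf * norm (u - v)"
    and b: "b \<in> range ((*v) A)"
    and \<sigma>: "\<sigma> = smallest_pos_eigenvalue (transpose A ** A)" "\<sigma> > 0"
    and pos: "\<gamma> > 0" "\<beta> > 0" "\<alpha> > 0"
    and par: "\<beta> \<le> \<alpha> * (\<gamma>\<^sup>2 * \<sigma>) * \<beta>\<^sup>2"
      "2 * \<alpha> * (1 + \<gamma> * Lf)\<^sup>2 \<le> 1 / 2 * (1 / \<gamma> - \<rho>)"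
      "2 * \<alpha> * \<eta>\<^sup>2 \<le> \<eta> * (2 - \<eta>) / (2 * \<gamma>)"
  shows "meal_energy f A b \<gamma> \<beta> \<alpha> x z l (Suc (Suc k)) \<le> meal_energy f A b \<gamma> \<beta> \<alpha> x z l (Suc k)"
proof -
  define p p' q q' where "p = x (Suc k)" and "p' = x (Suc (Suc k))"
    and "q = z (Suc k)" and "q' = z (Suc (Suc k))"
  define m m' where "m = l (Suc k)" and "m' = l (Suc (Suc k))"
  let ?P = "proximal_lagrangian f A b \<gamma> \<beta>"
  let ?s = "meal_subgradient A \<gamma> x z l"
  define R X Z D where "R = (norm (A *v p' - b))\<^sup>2" and "X = (norm (p' - p))\<^sup>2"
    and "Z = (norm (q - z k))\<^sup>2" and "D = (norm (q - p'))\<^sup>2"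
  have q': "q' = q - \<eta> *\<^sub>R (q - p')" and m': "m' = m + \<beta> *\<^sub>R (A *v p' - b)"
    using meal by (auto simp: meal_sequence_def p'_def q_def q'_def m_def m'_def)
  have sub: "weak_subgradient \<rho> f (x (Suc i)) (?s i)" for i
    by (rule weak_subgradient_meal[OF wc meal])
  have "?s (Suc k) = (1 / \<gamma>) *\<^sub>R (q - p') - transpose A *v (m + \<beta> *\<^sub>R (A *v p' - b))"
    unfolding meal_subgradient_def m'[symmetric] by (simp only: q_def p'_def m'_def)
  then have "weak_subgradient \<rho> f p'
      ((1 / \<gamma>) *\<^sub>R (q - p') - transpose A *v (m + \<beta> *\<^sub>R (A *v p' - b)))"
    using sub[of "Suc k"] by (simp only: p'_def)
  from proximal_lagrangian_descent[OF this, of p] pos(2)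
  have "?P p' q m + 1 / 2 * (1 / \<gamma> - \<rho>) * X \<le> ?P p q m"
    by (simp add: X_def norm_minus_commute)
  moreover have "?P p' q' m' = ?P p' q m + \<beta> * R - \<eta> * (2 - \<eta>) / (2 * \<gamma>) * D"
    unfolding R_def D_def by (rule proximal_lagrangian_update[OF q' m'])
  moreover have "(norm (q' - q))\<^sup>2 = \<eta>\<^sup>2 * D"
    by (simp add: q' D_def power_mult_distrib)
  then have "2 * \<alpha> * (norm (q' - q))\<^sup>2 \<le> \<eta> * (2 - \<eta>) / (2 * \<gamma>) * D"
    using mult_right_mono[OF par(3), of D] by (simp add: D_def mult.assoc)
  moreover have "\<beta> * R \<le> 1 / 2 * (1 / \<gamma> - \<rho>) * X + 2 * \<alpha> * Z"
  proof -
    have inc: "m' - m = \<beta> *\<^sub>R (A *v p' - b)" by (simp add: m')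
    have "\<gamma>\<^sup>2 * \<sigma> * (norm (m' - m))\<^sup>2
        \<le> 2 * (1 + \<gamma> * Lf)\<^sup>2 * (norm (p' - p))\<^sup>2 + 2 * (norm (q - z k))\<^sup>2"
    proof (rule multiplier_increment_bound[OF \<sigma> pos(1)])
      show "?s k = (1 / \<gamma>) *\<^sub>R (z k - p) - transpose A *v m"
        by (simp only: meal_subgradient_def p_def m_def)
      show "?s (Suc k) = (1 / \<gamma>) *\<^sub>R (q - p') - transpose A *v m'"
        by (simp only: meal_subgradient_def p'_def q_def m'_def)
      show "norm (?s (Suc k) - ?s k) \<le> Lf * norm (p' - p)"
        unfolding p_def p'_def by (intro lip sub)
      show "m' - m \<in> range ((*v) A)"
        unfolding inc by (rule residual_in_range[OF b])
    qed
    then have "\<gamma>\<^sup>2 * \<sigma> * (\<beta>\<^sup>2 * R) \<le> 2 * (1 + \<gamma> * Lf)\<^sup>2 * X + 2 * Z"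
      by (simp add: inc R_def X_def Z_def power_mult_distrib)
    then have "\<alpha> * (\<gamma>\<^sup>2 * \<sigma> * (\<beta>\<^sup>2 * R)) \<le> \<alpha> * (2 * (1 + \<gamma> * Lf)\<^sup>2 * X + 2 * Z)"
      using pos(3) by (intro mult_left_mono) auto
    also have "\<dots> = 2 * \<alpha> * (1 + \<gamma> * Lf)\<^sup>2 * X + 2 * \<alpha> * Z" by (simp add: distrib_left)
    also have "\<dots> \<le> 1 / 2 * (1 / \<gamma> - \<rho>) * X + 2 * \<alpha> * Z"
      using mult_right_mono[OF par(2), of X] by (simp add: X_def)
    finally have "\<alpha> * (\<gamma>\<^sup>2 * \<sigma> * (\<beta>\<^sup>2 * R)) \<le> 1 / 2 * (1 / \<gamma> - \<rho>) * X + 2 * \<alpha> * Z" .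
    moreover have "\<beta> * R \<le> \<alpha> * (\<gamma>\<^sup>2 * \<sigma> * (\<beta>\<^sup>2 * R))"
      using mult_right_mono[OF par(1), of R] by (simp add: R_def mult.assoc)
    ultimately show ?thesis by simp
  qed
  ultimately have "?P p' q' m' + 2 * \<alpha> * (norm (q' - q))\<^sup>2 \<le> ?P p q m + 2 * \<alpha> * Z"
    by linarith
  then show ?thesis
    by (simp add: meal_energy_def p_def p'_def q_def q'_def m_def m'_def Z_def)
qed

text \<open>The point \<open>y\<close> is the orthogonal projection of the iterate onto the feasible set, so its distance to
  the iterate is at most the norm of the residual divided by \<open>sqrt \<sigma>\<close>.\<close>

lemma meal_energy_lower_bound:
  fixes A :: "real^'n^'m"
  assumes wc: "weakly_convex \<rho> f" and meal: "meal_sequence f A b \<gamma> \<beta> \<eta> x z l"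
    and lip: "\<And>u v s s'. weak_subgradient \<rho> f u s \<Longrightarrow> weak_subgradient \<rho> f v s' \<Longrightarrow>
                norm (s - s') \<le> Lf * norm (u - v)"
    and b: "b \<in> range ((*v) A)"
    and \<sigma>: "\<sigma> = smallest_pos_eigenvalue (transpose A ** A)" "\<sigma> > 0"
    and pos: "\<gamma> > 0" "\<beta> > 0" "\<alpha> > 0"
    and coef: "\<rho> / 2 + Lf + 1 / (2 * \<gamma>) + 1 / (8 * \<alpha> * \<gamma>\<^sup>2) \<le> 3 / 8 * \<beta> * \<sigma>"
  obtains y where "A *v y = b"
    and "\<sigma> * (norm (x (Suc k) - y))\<^sup>2 \<le> (norm (A *v x (Suc k) - b))\<^sup>2"
    and "f y + 1 / (2 * \<gamma>) * (norm (y - z (Suc k)))\<^sup>2 + \<beta> / 8 * (norm (A *v x (Suc k) - b))\<^sup>2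
           \<le> meal_energy f A b \<gamma> \<beta> \<alpha> x z l (Suc k)"
proof -
  define p where "p = x (Suc k)"
  have "A *v p - b \<in> range ((*v) A)" using residual_in_range[OF b, of 1] by simp
  then obtain e where e: "A *v e = A *v p - b" "\<sigma> * (norm e)\<^sup>2 \<le> (norm (A *v p - b))\<^sup>2"
    using range_matrix_preimage unfolding \<sigma>(1) by blast
  obtain s' where s': "weak_subgradient \<rho> f (p - e) s'" using weak_subgradient_exists[OF wc] by blast
  have sub: "weak_subgradient \<rho> f p (meal_subgradient A \<gamma> x z l k)"
    unfolding p_def by (rule weak_subgradient_meal[OF wc meal])
  have "norm (s' - meal_subgradient A \<gamma> x z l k) \<le> Lf * norm e"
    using lip[OF s' sub] by simp
  from proximal_lagrangian_lower_bound[OF pos(1) pos(3) e \<sigma>(2) _ s' this coef pos(2),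
      where l = "l (Suc k)" and z = "z k" and z' = "z (Suc k)"]
  have "f (p - e) + 1 / (2 * \<gamma>) * (norm (p - e - z (Suc k)))\<^sup>2 + \<beta> / 8 * (norm (A *v p - b))\<^sup>2
      \<le> meal_energy f A b \<gamma> \<beta> \<alpha> x z l (Suc k)"
    by (simp add: meal_energy_def meal_subgradient_def p_def)
  moreover have "A *v (p - e) = b" using e(1) by (simp add: matrix_vector_mult_diff_distrib)
  ultimately show thesis using e(2) by (intro that[of "p - e"]) (simp_all add: p_def)
qed

lemma bounded_range_Suc:
  fixes g :: "nat \<Rightarrow> 'v::real_normed_vector"
  assumes "\<And>k. norm (g (Suc k)) \<le> B"
  shows "bounded (range g)"
proof -
  have "norm (g k) \<le> max B (norm (g 0))" for k
    by (cases k) (use assms in \<open>auto simp: le_max_iff_disj\<close>)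
  then show ?thesis by (auto simp: bounded_iff)
qed

theorem proposition4:
  fixes f :: "real^'n \<Rightarrow> real" and A :: "real^'n^'m" and b :: "real^'m"
    and x z :: "nat \<Rightarrow> real^'n" and l :: "nat \<Rightarrow> real^'m"
    and Lf :: "real \<Rightarrow> real"
    and \<rho> \<gamma> \<eta> \<beta> \<delta> M \<sigma> c L a1 a2 a3 \<alpha> \<alpha>max E0 fstar B0 B1 :: real
    and X :: "(real^'n) set"
  assumes X_def: "X = {y. A *v y = b}"
    and X_nonempty: "X \<noteq> {}"
    and rho: "\<rho> > 0"
    and f_lsc: "lower_semicontinuous f"
    and f_wconvex: "weakly_convex \<rho> f"
    and f_lipschitz: "implicit_lipschitz_subgradient \<rho> f Lf"
    and fstar_def: "fstar = Inf (f ` X)"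
    and fstar_finite: "bdd_below (f ` X)"
    and coercive: "filterlim f at_top (inf at_infinity (principal X))"
    and gamma: "0 < \<gamma>" "\<gamma> < 1 / \<rho>"
    and eta: "0 < \<eta>" "\<eta> < 2"
    and sigma_def: "\<sigma> = smallest_pos_eigenvalue (transpose A ** A)"
    and c_def: "c = \<gamma>\<^sup>2 * \<sigma>"
    and alpha_def: "\<alpha> = (2 * \<beta> + \<gamma> * \<eta> * (1 - \<eta> / 2)) / (2 * c * \<beta>\<^sup>2)"
    and meal: "meal_sequence f A b \<gamma> \<beta> \<eta> x z l"
    and E0_def: "E0 = meal_energy f A b \<gamma> \<beta> \<alpha> x z l 1"
    and B0_pos: "B0 > 0"
    and B0_bound: "\<And>y. y \<in> X \<Longrightarrow> f y \<le> E0 \<Longrightarrow> norm y \<le> B0"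
    and B1_def: "B1 = B0 + sqrt (2 * inverse \<rho> * max 0 (E0 - fstar))"
    and z0: "norm (z 0) \<le> B1"
    and delta: "\<delta> > 0"
    and M: "0 < M" "M < 2 / sqrt \<sigma>"
    and stability: "local_stability f A b \<gamma> B1 \<delta> M"
    and L_def: "L = \<rho> + 2 * Lf \<gamma>"
    and alphamax_def: "\<alpha>max = min ((1 - \<gamma> * \<rho>) / (4 * \<gamma> * (1 + \<gamma> * Lf \<gamma>)\<^sup>2))
                                 (1 / (8 * \<gamma>) * (2 / \<eta> - 1))"
    and a1_def: "a1 = 4 - M\<^sup>2 * \<sigma>"
    and a2_def: "a2 = 4 * (L + inverse \<gamma>) * M\<^sup>2 - \<gamma> * \<eta> * (2 - \<eta>)"
    and a3_def: "a3 = (1 + \<gamma> * L) * \<eta> * (2 - \<eta>) * M\<^sup>2"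
    and beta: "\<beta> > max ((1 + sqrt (1 + \<eta> * (2 - \<eta>) * \<gamma> * c * \<alpha>max)) / (2 * c * \<alpha>max))
                       ((a2 + sqrt (a2\<^sup>2 + 4 * a1 * a3)) / (2 * a1))"
  shows "bdd_below (meal_energy f A b \<gamma> \<beta> \<alpha> x z l ` {1..})
       \<and> bounded (range (\<lambda>k. (x k, z k)))
       \<and> (transpose A *v l 0 = 0 \<and>
          ereal (norm (gradient (moreau_envelope \<gamma> f) (z 0 - \<gamma> *\<^sub>R (transpose A *v l 1)))) < \<infinity>
          \<longrightarrow> bounded (range l))"
proof -
  define \<kappa> where "\<kappa> = Lf \<gamma>"
  let ?E = "meal_energy f A b \<gamma> \<beta> \<alpha> x z l"
  have \<gamma>\<rho>: "\<gamma> * \<rho> < 1" using gamma rho by (simp add: field_simps)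
  have \<kappa>: "\<kappa> > 0"
    using f_lipschitz gamma by (simp add: implicit_lipschitz_subgradient_def \<kappa>_def)
  have \<sigma>: "\<sigma> > 0"
  proof (rule ccontr)
    assume "\<not> \<sigma> > 0"
    \<comment> \<open>The root of a nonpositive real is nonpositive, and division by 0 gives 0.\<close>
    then have "2 / sqrt \<sigma> \<le> 0" by (simp add: divide_nonneg_nonpos)
    with M show False by simp
  qed
  have lip: "norm (s - s') \<le> \<kappa> * norm (u - v)"
    if "weak_subgradient \<rho> f u s" "weak_subgradient \<rho> f v s'" for u v s s'
    unfolding \<kappa>_def
    by (rule weak_subgradient_Lipschitz[OF f_wconvex f_lipschitz rho gamma(1) \<gamma>\<rho> that])
  obtain y0 where y0: "y0 \<in> X" using X_nonempty by blast
  then have "b = A *v y0" by (simp add: X_def)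
  then have b: "b \<in> range ((*v) A)" by (rule range_eqI)
  have "\<beta> > (1 + sqrt (1 + \<eta> * (2 - \<eta>) * \<gamma> * c * \<alpha>max)) / (2 * c * \<alpha>max)" using beta by simp
  note par = meal_parameter_bounds[OF rho gamma(1) \<gamma>\<rho> eta \<sigma> \<kappa> c_def alpha_def
      alphamax_def[folded \<kappa>_def] this]
  have decr: "?E (Suc (Suc k)) \<le> ?E (Suc k)" for k
    by (rule meal_energy_decreasing[OF f_wconvex meal lip b sigma_def \<sigma> gamma(1) par(1,2)
          par(3)[unfolded c_def] par(4,5)])
  have E_le: "?E (Suc k) \<le> E0" for k
    by (induction k) (use decr in \<open>auto simp: E0_def intro: order_trans\<close>)
  have "\<exists>y. A *v y = b \<and> \<sigma> * (norm (x (Suc k) - y))\<^sup>2 \<le> (norm (A *v x (Suc k) - b))\<^sup>2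
      \<and> f y + 1 / (2 * \<gamma>) * (norm (y - z (Suc k)))\<^sup>2 + \<beta> / 8 * (norm (A *v x (Suc k) - b))\<^sup>2
        \<le> ?E (Suc k)" for k
    by (rule meal_energy_lower_bound[OF f_wconvex meal lip b sigma_def \<sigma> gamma(1) par(1,2,6)])
      blast+
  then obtain y where y: "\<And>k. A *v y k = b"
    and xy: "\<And>k. \<sigma> * (norm (x (Suc k) - y k))\<^sup>2 \<le> (norm (A *v x (Suc k) - b))\<^sup>2"
    and E_ge: "\<And>k. f (y k) + 1 / (2 * \<gamma>) * (norm (y k - z (Suc k)))\<^sup>2
        + \<beta> / 8 * (norm (A *v x (Suc k) - b))\<^sup>2 \<le> ?E (Suc k)"
    by metis
  have fstar: "fstar \<le> f (y k)" for k
    unfolding fstar_def using y by (intro cINF_lower fstar_finite) (auto simp: X_def)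
  have nonneg: "0 \<le> 1 / (2 * \<gamma>) * (norm (y k - z (Suc k)))\<^sup>2"
    "0 \<le> \<beta> / 8 * (norm (A *v x (Suc k) - b))\<^sup>2" for k
    using gamma(1) par(1) by simp_all
  have a: "bdd_below (?E ` {1..})"
  proof (rule bdd_belowI2)
    fix k :: nat assume "k \<in> {1..}"
    then obtain j where "k = Suc j" by (cases k) auto
    then show "fstar \<le> ?E k" using fstar[of j] nonneg[of j] E_ge[of j] by simp
  qed
  have yB: "norm (y k) \<le> B0" for k
    using nonneg[of k] E_ge[of k] E_le[of k] y by (intro B0_bound) (auto simp: X_def)
  define G where "G = E0 - fstar"
  have zy: "norm (y k - z (Suc k)) \<le> sqrt (2 * \<gamma> * G)" for k
  proof (rule real_le_rsqrt)
    have "1 / (2 * \<gamma>) * (norm (y k - z (Suc k)))\<^sup>2 \<le> G"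
      using nonneg(2)[of k] E_ge[of k] E_le[of k] fstar[of k] by (simp add: G_def)
    then show "(norm (y k - z (Suc k)))\<^sup>2 \<le> 2 * \<gamma> * G" using gamma(1) by (simp add: field_simps)
  qed
  have xy': "norm (x (Suc k) - y k) \<le> sqrt (8 * G / (\<beta> * \<sigma>))" for k
  proof (rule real_le_rsqrt)
    have "\<beta> / 8 * (norm (A *v x (Suc k) - b))\<^sup>2 \<le> G"
      using nonneg(1)[of k] E_ge[of k] E_le[of k] fstar[of k] by (simp add: G_def)
    moreover have "\<beta> / 8 * (\<sigma> * (norm (x (Suc k) - y k))\<^sup>2)
        \<le> \<beta> / 8 * (norm (A *v x (Suc k) - b))\<^sup>2"
      using xy par(1) by (intro mult_left_mono) auto
    ultimately have "\<beta> / 8 * (\<sigma> * (norm (x (Suc k) - y k))\<^sup>2) \<le> G" by simp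
    then show "(norm (x (Suc k) - y k))\<^sup>2 \<le> 8 * G / (\<beta> * \<sigma>)"
      using par(1) \<sigma> by (simp add: field_simps)
  qed
  have zB: "norm (z (Suc k)) \<le> B0 + sqrt (2 * \<gamma> * G)" for k
    using yB[of k] zy[of k] norm_triangle_sub[of "z (Suc k)" "y k"]
    by (simp add: norm_minus_commute)
  have xB: "norm (x (Suc k)) \<le> B0 + sqrt (8 * G / (\<beta> * \<sigma>))" for k
    using yB[of k] xy'[of k] norm_triangle_sub[of "x (Suc k)" "y k"] by simp
  have bx: "bounded (range x)" and bz: "bounded (range z)"
    using xB zB by (auto intro: bounded_range_Suc)
  then have "bounded (range x \<times> range z)" by (rule bounded_Times)
  then have b_xz: "bounded (range (\<lambda>k. (x k, z k)))" by (rule bounded_subset) auto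
  have bl: "bounded (range l)"
  proof -
    obtain Bx Bz where Bx: "\<And>k. norm (x k) \<le> Bx" and Bz: "\<And>k. norm (z k) \<le> Bz"
      using bx bz by (auto simp: bounded_iff)
    let ?s = "meal_subgradient A \<gamma> x z l"
    define C where "C = (1 / \<gamma>) * (Bz + Bx) + (\<kappa> * (Bx + Bx) + norm (?s 0))"
    have range_l: "l k - l 0 \<in> range ((*v) A)" for k
    proof (induction k)
      case 0
      have "l 0 - l 0 = A *v 0" by simp
      then show ?case by (rule range_eqI)
    next
      case (Suc k)
      have "l (Suc k) - l 0 = (l k - l 0) + \<beta> *\<^sub>R (A *v x (Suc k) - b)"
        using meal by (simp add: meal_sequence_def)
      also have "\<dots> \<in> range ((*v) A)"
        by (intro subspace_add Suc residual_in_range[OF b] linear_subspace_image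
            matrix_vector_mul_linear subspace_UNIV)
      finally show ?case .
    qed
    have Al: "norm (transpose A *v l (Suc k)) \<le> C" for k
    proof -
      have "transpose A *v l (Suc k) = (1 / \<gamma>) *\<^sub>R (z k - x (Suc k)) - ?s k"
        by (simp add: meal_subgradient_def)
      then have "norm (transpose A *v l (Suc k)) \<le> norm ((1 / \<gamma>) *\<^sub>R (z k - x (Suc k))) + norm (?s k)"
        by (simp only: norm_triangle_ineq4)
      moreover have "norm ((1 / \<gamma>) *\<^sub>R (z k - x (Suc k))) \<le> (1 / \<gamma>) * (Bz + Bx)"
      proof -
        have "norm (z k - x (Suc k)) \<le> Bz + Bx"
          using norm_triangle_ineq4[of "z k" "x (Suc k)"] Bx[of "Suc k"] Bz[of k] by linarith
        then show ?thesis
          using gamma(1) by (simp add: divide_right_mono)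
      qed
      moreover have "norm (?s k) \<le> \<kappa> * (Bx + Bx) + norm (?s 0)"
      proof -
        have "norm (?s k - ?s 0) \<le> \<kappa> * norm (x (Suc k) - x (Suc 0))"
          by (intro lip weak_subgradient_meal[OF f_wconvex meal])
        also have "\<dots> \<le> \<kappa> * (Bx + Bx)"
          using norm_triangle_ineq4[of "x (Suc k)" "x (Suc 0)"] Bx[of "Suc k"] Bx[of "Suc 0"] \<kappa>
          by (intro mult_left_mono) auto
        finally show ?thesis using norm_triangle_sub[of "?s k" "?s 0"] by linarith
      qed
      ultimately show ?thesis unfolding C_def by linarith
    qed
    have "norm (l (Suc k)) \<le> norm (l 0) + (C + norm (transpose A *v l 0)) / sqrt \<sigma>" for k
    proof -
      let ?d = "l (Suc k) - l 0"
      have "sqrt \<sigma> * norm ?d = sqrt (\<sigma> * (norm ?d)\<^sup>2)" using \<sigma> by (simp add: real_sqrt_mult)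
      also have "\<dots> \<le> sqrt ((norm (transpose A *v ?d))\<^sup>2)"
        using smallest_pos_eigenvalue_le_transpose[OF range_l] \<sigma> unfolding sigma_def
        by (intro real_sqrt_le_mono) blast
      also have "\<dots> = norm (transpose A *v l (Suc k) - transpose A *v l 0)"
        by (simp add: matrix_vector_mult_diff_distrib del: transpose_matrix_vector)
      also have "\<dots> \<le> C + norm (transpose A *v l 0)"
        using Al[of k] norm_triangle_ineq4 by (meson add_right_mono order_trans)
      finally have "norm ?d \<le> (C + norm (transpose A *v l 0)) / sqrt \<sigma>"
        using \<sigma> by (simp add: field_simps)
      then show ?thesis using norm_triangle_sub[of "l (Suc k)" "l 0"] by linarith
    qed
    then show ?thesis by (rule bounded_range_Suc)
  qed
  show ?thesis using a b_xz bl by blast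
qed

end
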